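(* For every constant $\varepsilon>0$ and every integer $m_0=m_0(n)$ with $\frac{1+\varepsilon}{6}\,n\log n\le m_0\le\binom n2$, the random graph process $\{G_i\}_{i=0}^{\binom n2}$ on $n$ vertices with high probability (as $n\to\infty$) has the following property: for every integer $m$ with $m_0\le m\le(1+\varepsilon/6)m_0$ (and $m\le\binom n2$), the giant (largest connected component) of $G_m$ is not $(1/2+\varepsilon)$-resilient with respect to connectivity.
   Context: Random graph process: $G_0$ is the empty graph on $n$ vertices; for each $i\in\{1,\dots,\binom n2\}$, $G_i$ is obtained from $G_{i-1}$ by adding an edge $e\notin E(G_{i-1})$ chosen uniformly at random among the missing edges. With high probability: with probability tending to $1$ as $n\to\infty$. $\log$ is the natural logarithm. The giant of a graph is its largest connected component (regarded as a graph on its own vertex set). $\alpha$-resilience: Let $G=(V,E)$ be a graph, $\mathcal P$ a monotone increasing graph property, and $\alpha$ a real constant. $G$ is $\alpha$-resilient with respect to $\mathcal P$ if for every spanning subgraph $H\subseteq G$ satisfying $\deg_H(v)\le \alpha\deg_G(v)$ for all $v\in V$, we have $G-H\in\mathcal P$, where $G-H$ is the graph on $V$ with edge set $E(G)\setminus E(H)$. *)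

theory Defs
  imports "HOL-Probability.Probability" "HOL-Library.Ramsey"
begin

text \<open>A finite simple graph is a pair \<open>(V, E)\<close> with \<open>V\<close> finite and \<open>E \<subseteq> nsets V 2\<close>, where
  \<open>nsets V 2\<close> is the set of two-element subsets of \<open>V\<close>.\<close>

type_synonym 'a graph = "'a set \<times> 'a set set"

abbreviation verts :: "'a graph \<Rightarrow> 'a set" where "verts \<equiv> fst"

abbreviation edges :: "'a graph \<Rightarrow> 'a set set" where "edges \<equiv> snd"

definition simple_graph :: "'a graph \<Rightarrow> bool" where
  "simple_graph G \<longleftrightarrow> finite (verts G) \<and> edges G \<subseteq> nsets (verts G) 2"

definition graph_degree :: "'a graph \<Rightarrow> 'a \<Rightarrow> nat" where
  "graph_degree G v = card {e \<in> edges G. v \<in> e}"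

definition reachable :: "'a graph \<Rightarrow> 'a \<Rightarrow> 'a \<Rightarrow> bool" where
  "reachable G u v \<longleftrightarrow> (u, v) \<in> {(x, y). {x, y} \<in> edges G}\<^sup>*"

definition connected_graph :: "'a graph \<Rightarrow> bool" where
  "connected_graph G \<longleftrightarrow> verts G \<noteq> {} \<and> (\<forall>u \<in> verts G. \<forall>v \<in> verts G. reachable G u v)"

definition graph_components :: "'a graph \<Rightarrow> 'a set set" where
  "graph_components G = {{u \<in> verts G. reachable G v u} | v. v \<in> verts G}"

definition induced :: "'a graph \<Rightarrow> 'a set \<Rightarrow> 'a graph" where
  "induced G U = (U, {e \<in> edges G. e \<subseteq> U})"

text \<open>A predicate rather than a function, since the component of maximum order need not be
  unique.\<close>

definition is_giant :: "'a graph \<Rightarrow> 'a graph \<Rightarrow> bool" where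
  "is_giant G L \<longleftrightarrow> (\<exists>C \<in> graph_components G. (\<forall>D \<in> graph_components G. card D \<le> card C) \<and> L = induced G C)"

definition spanning_subgraph :: "'a graph \<Rightarrow> 'a graph \<Rightarrow> bool" where
  "spanning_subgraph H G \<longleftrightarrow> verts H = verts G \<and> edges H \<subseteq> edges G"

definition graph_diff :: "'a graph \<Rightarrow> 'a graph \<Rightarrow> 'a graph" where
  "graph_diff G H = (verts G, edges G - edges H)"

definition monotone_increasing :: "('a graph \<Rightarrow> bool) \<Rightarrow> bool" where
  "monotone_increasing P \<longleftrightarrow>
     (\<forall>G H. simple_graph G \<and> spanning_subgraph H G \<and> P H \<longrightarrow> P G)"

text \<open>Intended for \<open>monotone_increasing\<close> properties \<open>P\<close>.\<close>

definition resilient :: "real \<Rightarrow> ('a graph \<Rightarrow> bool) \<Rightarrow> 'a graph \<Rightarrow> bool" where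
  "resilient \<alpha> P G \<longleftrightarrow>
     (\<forall>H. spanning_subgraph H G \<and>
          (\<forall>v \<in> verts G. real (graph_degree H v) \<le> \<alpha> * real (graph_degree G v)) \<longrightarrow>
          P (graph_diff G H))"

lemma monotone_increasing_connected_graph: "monotone_increasing connected_graph"
  unfolding monotone_increasing_def
proof (intro allI impI, elim conjE)
  fix G H :: "'a graph"
  assume sub: "spanning_subgraph H G" and con: "connected_graph H"
  have "{(x, y). {x, y} \<in> edges H}\<^sup>* \<subseteq> {(x, y). {x, y} \<in> edges G}\<^sup>*"
    using sub by (intro rtrancl_mono) (auto simp: spanning_subgraph_def)
  with sub con show "connected_graph G"
    unfolding connected_graph_def spanning_subgraph_def reachable_def by (simp add: subset_iff)
qed

text \<open>The joint law of \<open>[G\<^sub>0, \<dots>, G\<^sub>i]\<close> on the vertex set \<open>{..<n}\<close>. It is meaningful for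
  \<open>i \<le> n choose 2\<close>: beyond that, no missing edge is left to choose.\<close>

primrec process_upto :: "nat \<Rightarrow> nat \<Rightarrow> nat graph list pmf" where
  "process_upto n 0 = return_pmf [({..<n}, {})]"
| "process_upto n (Suc i) =
     bind_pmf (process_upto n i) (\<lambda>Gs.
       map_pmf (\<lambda>e. Gs @ [({..<n}, insert e (edges (last Gs)))])
         (pmf_of_set (nsets {..<n} 2 - edges (last Gs))))"

definition random_graph_process :: "nat \<Rightarrow> nat graph list pmf" where
  "random_graph_process n = process_upto n (n choose 2)"

lemma process_upto_support:
  assumes "Gs \<in> set_pmf (process_upto n i)" and "i \<le> n choose 2"
  shows "length Gs = Suc i \<and>
    (\<forall>j \<le> i. verts (Gs ! j) = {..<n} \<and> edges (Gs ! j) \<subseteq> nsets {..<n} 2 \<and> card (edges (Gs ! j)) = j)"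
  using assms
proof (induction i arbitrary: Gs)
  case 0
  then show ?case by simp
next
  case (Suc i)
  let ?K = "nsets {..<n} 2"
  have fin: "finite ?K" and cardK: "card ?K = n choose 2"
    by (simp_all add: finite_imp_finite_nsets)
  from Suc.prems(1) obtain Fs e where
    Fs: "Fs \<in> set_pmf (process_upto n i)" and
    e: "e \<in> set_pmf (pmf_of_set (?K - edges (last Fs)))" and
    Gs: "Gs = Fs @ [({..<n}, insert e (edges (last Fs)))]"
    by auto
  from Suc.IH[OF Fs] Suc.prems(2)
  have len: "length Fs = Suc i" and
    IH: "\<And>j. j \<le> i \<Longrightarrow> verts (Fs ! j) = {..<n} \<and> edges (Fs ! j) \<subseteq> ?K \<and> card (edges (Fs ! j)) = j"
    by simp_all
  have last: "last Fs = Fs ! i"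
    using len by (metis diff_Suc_1 last_conv_nth list.size(3) nat.distinct(1))
  have sub: "edges (last Fs) \<subseteq> ?K" and card: "card (edges (last Fs)) = i"
    using IH[of i] last by auto
  have "?K - edges (last Fs) \<noteq> {}"
    using sub card cardK fin Suc.prems(2) by (metis Diff_eq_empty_iff Suc_n_not_le_n subset_antisym)
  with e fin have "e \<in> ?K - edges (last Fs)" by simp
  moreover have "finite (edges (last Fs))" using sub fin by (rule finite_subset)
  ultimately show ?case
    using len IH sub card Gs by (simp add: nth_append le_Suc_eq)
qed

end

theory Submission imports Defs "HOL-Real_Asymp.Real_Asymp" begin

text \<open>
  Fix a bisection of the vertex set. A typical vertex has about half of its neighbours on either
  side; call the others unbalanced (this includes every vertex of small degree). With probability
  polynomially close to \<open>1\<close>, no vertex has more than a constant number \<open>K\<close> of unbalanced neighbours,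
  because \<open>K\<close> neighbours of a vertex are unbalanced almost independently, each with probability at
  most a fixed negative power of \<open>n\<close>. Now reassign the sides of the unbalanced vertices so
  that the number of crossing edges becomes minimal. By local minimality at most half of the edges
  at an unbalanced vertex cross, and at a balanced vertex the crossing degree changes by at most
  \<open>K\<close>. Hence the adversary may delete all crossing edges of the giant. This disconnects the giant,
  because it contains a balanced vertex: otherwise linearly many vertices would span only linearly
  many edges. The probabilities are estimated in the binomial model, at the price of a factor
  \<open>n\<^sup>2\<close>, and a union bound over the times \<open>m\<close> costs another \<open>n\<^sup>2\<close>.
\<close>

section \<open>Marginals of the process\<close>

text \<open>A set \<open>X\<close> of size \<open>Suc i\<close> arises from exactly its
  \<open>Suc i\<close> subsets \<open>E\<close> of size \<open>i\<close>, and from each of them by a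
  single choice of \<open>e\<close>, of probability \<open>1 / (card K - i)\<close>. So the
  resulting law is constant on the sets of size \<open>Suc i\<close>.\<close>

lemma pmf_of_set_insert_subsets:
  assumes fin: "finite K" and i: "i < card K"
  shows "bind_pmf (pmf_of_set {E. E \<subseteq> K \<and> card E = i}) (\<lambda>E. map_pmf (\<lambda>e. insert e E) (pmf_of_set (K - E)))
       = pmf_of_set {E. E \<subseteq> K \<and> card E = Suc i}" (is "?L = pmf_of_set ?S'")
proof (rule pmf_eqI)
  fix X
  let ?S = "{E. E \<subseteq> K \<and> card E = i}"
  have finS: "finite ?S" "finite ?S'" using fin by auto
  have cS: "card ?S = card K choose i" and cS': "card ?S' = card K choose Suc i"
    using fin by (simp_all add: n_subsets)
  have neS: "?S \<noteq> {}" "?S' \<noteq> {}"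
    using cS cS' i by (metis card.empty less_imp_le_nat binomial_eq_0_iff not_less, metis Suc_leI card.empty binomial_eq_0_iff not_less)
  have step: "pmf (map_pmf (\<lambda>e. insert e E) (pmf_of_set (K - E))) X
      = (if X \<in> ?S' \<and> E \<subseteq> X then 1 / real (card K - i) else 0)" if E: "E \<in> ?S" for E
  proof -
    have finE: "finite E" using E fin finite_subset by auto
    have cd: "card (K - E) = card K - i" using E fin finE by (simp add: card_Diff_subset)
    have ne: "K - E \<noteq> {}" using cd i by (metis card.empty zero_less_diff less_irrefl)
    have "pmf (map_pmf (\<lambda>e. insert e E) (pmf_of_set (K - E))) X
        = real (card ((K - E) \<inter> (\<lambda>e. insert e E) -` {X})) / real (card (K - E))"
      using fin ne by (simp add: pmf_map measure_pmf_of_set)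
    also have "(K - E) \<inter> (\<lambda>e. insert e E) -` {X} = (if X \<in> ?S' \<and> E \<subseteq> X then X - E else {})"
    proof (cases "X \<in> ?S' \<and> E \<subseteq> X")
      case True
      have "insert e E = X" if "e \<in> X - E" for e
        using True that E finE fin
        by (intro card_subset_eq) (auto intro: finite_subset)
      then show ?thesis using True by auto
    next
      case False
      then show ?thesis using E finE by (auto simp: card_insert_if)
    qed
    also have "real (card (if X \<in> ?S' \<and> E \<subseteq> X then X - E else {}))
        = (if X \<in> ?S' \<and> E \<subseteq> X then 1 else 0)"
      using E finE by (auto simp: card_Diff_subset)
    finally show ?thesis by (simp add: cd)
  qed
  have "pmf ?L X = (\<Sum>E\<in>?S. pmf (map_pmf (\<lambda>e. insert e E) (pmf_of_set (K - E))) X) / card ?S"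
    using finS neS by (simp add: pmf_bind_pmf_of_set)
  also have "(\<Sum>E\<in>?S. pmf (map_pmf (\<lambda>e. insert e E) (pmf_of_set (K - E))) X)
      = (\<Sum>E\<in>?S. if X \<in> ?S' \<and> E \<subseteq> X then 1 / real (card K - i) else 0)"
    by (intro sum.cong refl step)
  also have "\<dots> = (if X \<in> ?S' then real (Suc i) / real (card K - i) else 0)"
  proof (cases "X \<in> ?S'")
    case True
    have "?S \<inter> {E. E \<subseteq> X} = {E. E \<subseteq> X \<and> card E = i}" using True by auto
    moreover have "card {E. E \<subseteq> X \<and> card E = i} = Suc i"
      using True fin finite_subset[of X K] by (simp add: n_subsets)
    ultimately show ?thesis using True finS by (simp add: sum.If_cases)
  next
    case False
    then show ?thesis by (simp only: if_False simp_thms sum.neutral_const)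
  qed
  also have "\<dots> / card ?S = (if X \<in> ?S' then 1 / real (card ?S') else 0)"
  proof -
    \<comment> \<open>Both sides count the pairs \<open>E \<subset> X\<close> of subsets of
      \<open>K\<close> of sizes \<open>i\<close> and \<open>Suc i\<close>.\<close>
    have "(card K choose i) * (card K - i) = (card K choose Suc i) * Suc i"
      using binomial_absorb_comp[of "card K" i] binomial_absorption[of i "card K - 1"] i
      by (metis binomial_absorption mult.commute times_binomial_minus1_eq zero_less_Suc diff_Suc_1)
    then have "real (card K choose i) * real (card K - i) = real (card K choose Suc i) * real (Suc i)"
      by (metis of_nat_mult)
    moreover have "real (card K - i) > 0" "real (card K choose i) > 0" "real (card K choose Suc i) > 0"
      using i by auto
    ultimately show ?thesis
      by (simp add: cS cS' field_simps del: of_nat_Suc)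
  qed
  also have "\<dots> = pmf (pmf_of_set ?S') X"
    using finS neS by (simp add: indicator_def)
  finally show "pmf ?L X = pmf (pmf_of_set ?S') X" .
qed

text \<open>The next edge depends on the history only through the last graph, so the law of the last
  graph evolves by the step of \<open>pmf_of_set_insert_subsets\<close> and stays uniform.\<close>

lemma map_last_process_upto:
  assumes "i \<le> n choose 2"
  shows "map_pmf last (process_upto n i)
       = map_pmf (Pair {..<n}) (pmf_of_set {E. E \<subseteq> nsets {..<n} 2 \<and> card E = i})"
  using assms
proof (induction i)
  case 0
  have "{E. E \<subseteq> nsets {..<n} 2 \<and> card E = 0} = {{}}"
    by (auto simp: finite_imp_finite_nsets dest: finite_subset)
  then show ?case by (simp add: pmf_of_set_singleton)
next
  case (Suc i)
  let ?K = "nsets {..<n} 2"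
  have K: "finite ?K" "card ?K = n choose 2" by (simp_all add: finite_imp_finite_nsets)
  have "map_pmf last (process_upto n (Suc i))
      = bind_pmf (map_pmf last (process_upto n i))
          (\<lambda>G. map_pmf (\<lambda>e. ({..<n}, insert e (edges G))) (pmf_of_set (?K - edges G)))"
    by (simp add: map_bind_pmf bind_map_pmf map_pmf_comp)
  also have "\<dots> = map_pmf (Pair {..<n}) (bind_pmf (pmf_of_set {E. E \<subseteq> ?K \<and> card E = i})
          (\<lambda>E. map_pmf (\<lambda>e. insert e E) (pmf_of_set (?K - E))))"
    using Suc by (simp add: map_bind_pmf bind_map_pmf map_pmf_comp)
  also have "\<dots> = map_pmf (Pair {..<n}) (pmf_of_set {E. E \<subseteq> ?K \<and> card E = Suc i})"
    using Suc.prems K by (simp add: pmf_of_set_insert_subsets)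
  finally show ?case .
qed

text \<open>Later steps only append to the list, so they leave entry \<open>m\<close> alone.\<close>

lemma map_nth_process_upto:
  assumes "m \<le> i" and "i \<le> n choose 2"
  shows "map_pmf (\<lambda>Gs. Gs ! m) (process_upto n i) = map_pmf last (process_upto n m)"
  using assms
proof (induction i rule: dec_induct)
  case base
  show ?case
  proof (rule map_pmf_cong[OF refl])
    fix Gs assume "Gs \<in> set_pmf (process_upto n m)"
    from process_upto_support[OF this base] show "Gs ! m = last Gs"
      by (metis diff_Suc_1 last_conv_nth list.size(3) nat.distinct(1))
  qed
next
  case (step i)
  have "map_pmf (\<lambda>Gs. Gs ! m) (process_upto n (Suc i))
      = bind_pmf (process_upto n i) (\<lambda>Gs. return_pmf (Gs ! m))"
    unfolding process_upto.simps map_bind_pmf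
  proof (rule bind_pmf_cong[OF refl])
    fix Gs assume "Gs \<in> set_pmf (process_upto n i)"
    then have "length Gs = Suc i" using process_upto_support step by simp
    then show "map_pmf (\<lambda>Gs. Gs ! m) (map_pmf (\<lambda>e. Gs @ [({..<n}, insert e (edges (last Gs)))])
        (pmf_of_set (nsets {..<n} 2 - edges (last Gs)))) = return_pmf (Gs ! m)"
      using step by (simp add: map_pmf_comp nth_append)
  qed
  then show ?case using step by (simp add: map_pmf_def)
qed

text \<open>The estimates for a single time \<open>m\<close> see the process only through this count
  of edge sets.\<close>

lemma prob_random_graph_process_nth:
  assumes "m \<le> n choose 2"
  shows "measure_pmf.prob (random_graph_process n) {Gs. P (Gs ! m)}
       = real (card {E. E \<subseteq> nsets {..<n} 2 \<and> card E = m \<and> P ({..<n}, E)}) / real ((n choose 2) choose m)"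
proof -
  let ?K = "nsets {..<n} 2" and ?S = "{E. E \<subseteq> nsets {..<n} 2 \<and> card E = m}"
  have K: "finite ?K" "card ?K = n choose 2" by (simp_all add: finite_imp_finite_nsets)
  have fin: "finite ?S" using K by auto
  have card: "card ?S = (n choose 2) choose m" using K by (simp add: n_subsets)
  then have ne: "?S \<noteq> {}"
    using assms by (metis card.empty binomial_eq_0_iff not_less)
  have "measure_pmf.prob (random_graph_process n) {Gs. P (Gs ! m)}
      = measure_pmf.prob (map_pmf (\<lambda>Gs. Gs ! m) (random_graph_process n)) {G. P G}"
    by (simp add: vimage_def)
  also have "\<dots> = measure_pmf.prob (pmf_of_set ?S) {E. P ({..<n}, E)}"
    using assms
    by (simp add: random_graph_process_def map_nth_process_upto map_last_process_upto vimage_def)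
  also have "\<dots> = real (card (?S \<inter> {E. P ({..<n}, E)})) / real (card ?S)"
    using fin ne by (rule measure_pmf_of_set[rotated])
  also have "?S \<inter> {E. P ({..<n}, E)} = {E. E \<subseteq> ?K \<and> card E = m \<and> P ({..<n}, E)}" by auto
  finally show ?thesis by (simp add: card)
qed

section \<open>Binomial random subsets\<close>

text \<open>The ratio of consecutive point probabilities is
  \<open>(N - k) * p / ((k + 1) * (1 - p))\<close>. With \<open>N * p = m\<close> it is at least 1
  for \<open>k < m\<close> and at most 1 for \<open>k \<ge> m\<close>, so the mean \<open>m\<close>
  is a mode.\<close>

lemma binomial_point_le_mode:
  fixes N m k :: nat
  defines "p \<equiv> real m / real N"
  assumes "m \<le> N" and "k \<le> N"
  shows "real (N choose k) * p ^ k * (1 - p) ^ (N - k) \<le> real (N choose m) * p ^ m * (1 - p) ^ (N - m)"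
proof -
  define f where "f k = real (N choose k) * p ^ k * (1 - p) ^ (N - k)" for k
  have p: "0 \<le> p" "p \<le> 1" and Np: "real N * p = real m"
    using assms by (auto simp: p_def divide_le_eq)
  \<comment> \<open>Both values are written as multiples of a common factor \<open>g\<close>; their
    quotient would be undefined where \<open>f\<close> vanishes, as it may for \<open>p = 0\<close>
    and \<open>p = 1\<close>.\<close>
  have step: "real (Suc k) * f (Suc k) = (real N - real k) * p * g \<and> real (Suc k) * f k = (real k + 1) * (1 - p) * g"
    if k: "k < N" and g: "g = real (N choose k) * p ^ k * (1 - p) ^ (N - Suc k)" for k g
  proof -
    have "Suc k * (N choose Suc k) = (N - k) * (N choose k)"
      using binomial_absorb_comp[of N k] binomial_absorption[of k "N - 1"] k
      by (metis binomial_absorption mult.commute times_binomial_minus1_eq zero_less_Suc diff_Suc_1)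
    then have "real (Suc k) * real (N choose Suc k) = (real N - real k) * real (N choose k)"
      using k by (metis of_nat_mult of_nat_diff less_imp_le)
    then have "real (Suc k) * f (Suc k) = (real N - real k) * p * g"
      unfolding f_def g power_Suc by (simp only: mult.assoc[symmetric]) (simp only: mult_ac)
    moreover have "N - k = Suc (N - Suc k)" using k by simp
    then have "real (Suc k) * f k = (real k + 1) * (1 - p) * g"
      unfolding f_def g by simp
    ultimately show ?thesis by simp
  qed
  have gp: "0 \<le> real (N choose k) * p ^ k * (1 - p) ^ (N - Suc k)" for k
    using p by simp
  have up: "f k \<le> f (Suc k)" if "k < m" for k
  proof -
    have "real k + 1 \<le> real m" using that by linarith
    then have "(real k + 1) * (1 - p) \<le> (real N - real k) * p"
      using Np p by (simp add: algebra_simps)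
    then have "real (Suc k) * f k \<le> real (Suc k) * f (Suc k)"
      unfolding step[OF less_le_trans[OF that assms(2)] refl, THEN conjunct1]
        step[OF less_le_trans[OF that assms(2)] refl, THEN conjunct2]
      by (rule mult_right_mono[OF _ gp])
    then show ?thesis by (simp del: of_nat_Suc)
  qed
  have down: "f (Suc k) \<le> f k" if "m \<le> k" "k < N" for k
  proof -
    have "(real N - real k) * p \<le> (real k + 1) * (1 - p)"
      using Np p that by (simp add: algebra_simps)
    then have "real (Suc k) * f (Suc k) \<le> real (Suc k) * f k"
      unfolding step[OF that(2) refl, THEN conjunct1] step[OF that(2) refl, THEN conjunct2]
      by (rule mult_right_mono[OF _ gp])
    then show ?thesis by (simp del: of_nat_Suc)
  qed
  have "f k \<le> f m"
  proof (cases "k \<le> m")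
    case True
    then show ?thesis
      by (induction k rule: inc_induct) (auto intro: order_trans[OF up])
  next
    case False
    then have "m \<le> k" by simp
    then show ?thesis using \<open>k \<le> N\<close>
      by (induction k rule: dec_induct) (auto intro: order_trans[OF down])
  qed
  then show ?thesis by (simp add: f_def)
qed

text \<open>The \<open>N + 1\<close> point probabilities sum to 1 and the one at \<open>m\<close> is
  the largest.\<close>

lemma binomial_mode_ge:
  fixes N m :: nat
  defines "p \<equiv> real m / real N"
  assumes "m \<le> N"
  shows "1 \<le> real (N + 1) * (real (N choose m) * p ^ m * (1 - p) ^ (N - m))"
proof -
  have "1 = (p + (1 - p)) ^ N" by simp
  also have "\<dots> = (\<Sum>k\<le>N. real (N choose k) * p ^ k * (1 - p) ^ (N - k))"
    by (rule binomial_ring)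
  also have "\<dots> \<le> (\<Sum>k\<le>N. real (N choose m) * p ^ m * (1 - p) ^ (N - m))"
    unfolding p_def using assms by (intro sum_mono binomial_point_le_mode) auto
  finally show ?thesis by simp
qed

text \<open>The expectation of \<open>f\<close> for a random subset of \<open>K\<close> that
  contains each element independently with probability \<open>p\<close>. As a finite sum it needs no
  measure space, and independence becomes the expansion of a product of sums.\<close>

definition subset_expectation :: "real \<Rightarrow> 'e set \<Rightarrow> ('e set \<Rightarrow> real) \<Rightarrow> real" where
  "subset_expectation p K f = (\<Sum>E\<in>Pow K. p ^ card E * (1 - p) ^ card (K - E) * f E)"

lemma subset_expectation_mono:
  assumes "0 \<le> p" "p \<le> 1" "\<And>E. E \<subseteq> K \<Longrightarrow> f E \<le> g E"
  shows "subset_expectation p K f \<le> subset_expectation p K g"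
  unfolding subset_expectation_def using assms by (intro sum_mono mult_left_mono) auto

lemma subset_expectation_sum:
  "subset_expectation p K (\<lambda>E. \<Sum>i\<in>I. f i E) = (\<Sum>i\<in>I. subset_expectation p K (f i))"
  unfolding subset_expectation_def by (simp add: sum_distrib_left sum.swap[of _ I])

lemma subset_expectation_cmult:
  "subset_expectation p K (\<lambda>E. c * f E) = c * subset_expectation p K f"
  unfolding subset_expectation_def by (simp add: sum_distrib_left mult_ac)

lemma subset_expectation_add:
  "subset_expectation p K (\<lambda>E. f E + g E) = subset_expectation p K f + subset_expectation p K g"
  unfolding subset_expectation_def by (simp add: sum.distrib algebra_simps)

text \<open>Independence: the factors depend on distinct elements of \<open>K\<close>. Expanding the
  product of the binomials over all of \<open>K\<close> yields one summand for every subset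
  \<open>E\<close>.\<close>

lemma subset_expectation_prod:
  assumes fin: "finite K" "finite I" and inj: "inj_on \<phi> I" and sub: "\<phi> ` I \<subseteq> K"
  shows "subset_expectation p K (\<lambda>E. \<Prod>i\<in>I. if \<phi> i \<in> E then \<alpha> i else \<beta> i)
       = (\<Prod>i\<in>I. p * \<alpha> i + (1 - p) * \<beta> i)"
proof -
  \<comment> \<open>The weights are carried over to \<open>K\<close> along \<open>\<phi>\<close>.
    Elements outside its image get weight 1 and thus contribute the factor
    \<open>p + (1 - p) = 1\<close>.\<close>
  define a b where "a e = (if e \<in> \<phi> ` I then \<alpha> (the_inv_into I \<phi> e) else 1)"
    and "b e = (if e \<in> \<phi> ` I then \<beta> (the_inv_into I \<phi> e) else 1)" for e
  have ab: "a (\<phi> i) = \<alpha> i" "b (\<phi> i) = \<beta> i" if "i \<in> I" for i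
    using that inj by (simp_all add: a_def b_def the_inv_into_f_f)
  have ext: "(\<Prod>i\<in>I. h (\<phi> i)) = (\<Prod>e\<in>K. h e)" if "\<And>e. e \<notin> \<phi> ` I \<Longrightarrow> h e = 1" for h :: "'a \<Rightarrow> real"
    using that fin sub by (subst prod.reindex[OF inj, symmetric, unfolded comp_def])
      (auto intro!: prod.mono_neutral_left)
  have "(\<Prod>i\<in>I. p * \<alpha> i + (1 - p) * \<beta> i) = (\<Prod>i\<in>I. p * a (\<phi> i) + (1 - p) * b (\<phi> i))"
    by (intro prod.cong) (simp_all add: ab)
  also have "\<dots> = (\<Prod>e\<in>K. p * a e + (1 - p) * b e)"
    by (intro ext[of "\<lambda>e. p * a e + (1 - p) * b e"]) (simp add: a_def b_def)
  also have "\<dots> = (\<Sum>E\<in>Pow K. (\<Prod>e\<in>E. p * a e) * (\<Prod>e\<in>K - E. (1 - p) * b e))"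
    using fin(1) by (rule prod_add)
  also have "\<dots> = subset_expectation p K (\<lambda>E. \<Prod>i\<in>I. if \<phi> i \<in> E then \<alpha> i else \<beta> i)"
    unfolding subset_expectation_def
  proof (rule sum.cong[OF refl])
    fix E assume "E \<in> Pow K"
    then have E: "E \<subseteq> K" by simp
    have "(\<Prod>i\<in>I. if \<phi> i \<in> E then \<alpha> i else \<beta> i) = (\<Prod>i\<in>I. if \<phi> i \<in> E then a (\<phi> i) else b (\<phi> i))"
      by (intro prod.cong) (simp_all add: ab)
    also have "\<dots> = (\<Prod>e\<in>K. if e \<in> E then a e else b e)"
      by (intro ext[of "\<lambda>e. if e \<in> E then a e else b e"]) (simp add: a_def b_def)
    also have "\<dots> = (\<Prod>e\<in>E. a e) * (\<Prod>e\<in>K - E. b e)"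
      using fin E by (simp add: prod.If_cases Int_absorb1 Diff_eq)
    finally show "(\<Prod>e\<in>E. p * a e) * (\<Prod>e\<in>K - E. (1 - p) * b e)
        = p ^ card E * (1 - p) ^ card (K - E) * (\<Prod>i\<in>I. if \<phi> i \<in> E then \<alpha> i else \<beta> i)"
      by (simp add: prod.distrib mult_ac)
  qed
  finally show ?thesis ..
qed

text \<open>Conditioned on having size \<open>m\<close>, the binomial random subset is uniform.
  Since \<open>m\<close> is its mean, that size has probability at least
  \<open>1 / (card K + 1)\<close>, so passing to the binomial model loses at most the factor
  \<open>card K + 1\<close>.\<close>

lemma uniform_le_subset_expectation:
  fixes K :: "'e set"
  assumes fin: "finite K" and m: "m \<le> card K"
  defines "p \<equiv> real m / real (card K)"
  shows "real (card {E. E \<subseteq> K \<and> card E = m \<and> P E}) / real (card K choose m)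
       \<le> real (card K + 1) * subset_expectation p K (\<lambda>E. of_bool (P E))"
proof -
  let ?X = "{E. E \<subseteq> K \<and> card E = m \<and> P E}" and ?N = "card K"
  let ?w = "p ^ m * (1 - p) ^ (?N - m)"
  have p: "0 \<le> p" "p \<le> 1" using m by (auto simp: p_def divide_le_eq)
  have "real (card ?X) * ?w = (\<Sum>E\<in>?X. p ^ card E * (1 - p) ^ card (K - E) * of_bool (P E))"
    using fin by (subst sum.cong[OF refl, of _ _ "\<lambda>_. ?w"]) (auto simp: card_Diff_subset finite_subset)
  also have "\<dots> \<le> subset_expectation p K (\<lambda>E. of_bool (P E))"
    unfolding subset_expectation_def using fin p by (intro sum_mono2) auto
  finally have X: "real (card ?X) * ?w \<le> subset_expectation p K (\<lambda>E. of_bool (P E))" .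
  have pos: "real (?N choose m) > 0" using m by simp
  have "real (card ?X) \<le> real (card ?X) * (real (?N + 1) * (real (?N choose m) * p ^ m * (1 - p) ^ (?N - m)))"
    using mult_left_mono[OF binomial_mode_ge[OF m], of "real (card ?X)"] by (simp add: p_def)
  also have "\<dots> = real (?N choose m) * (real (?N + 1) * (real (card ?X) * ?w))"
    by (simp add: mult_ac)
  also have "\<dots> \<le> real (?N choose m) * (real (?N + 1) * subset_expectation p K (\<lambda>E. of_bool (P E)))"
    using X by (intro mult_left_mono) auto
  finally show ?thesis
    using pos by (simp add: divide_le_eq mult.commute)
qed

text \<open>Pairs with one end in \<open>S\<close> and the other outside are distinct edges, hence independent.\<close>

lemma subset_expectation_cut_prod:
  fixes V :: "'a set"
  assumes "finite V" "S \<subseteq> V"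
  shows "subset_expectation p (nsets V 2) (\<lambda>E. \<Prod>w\<in>S. \<Prod>x\<in>V - S. if {w, x} \<in> E then \<alpha> w x else \<beta> w x)
       = (\<Prod>w\<in>S. \<Prod>x\<in>V - S. p * \<alpha> w x + (1 - p) * \<beta> w x)"
proof -
  have "finite S" "finite (V - S)" using assms finite_subset by auto
  have "subset_expectation p (nsets V 2)
      (\<lambda>E. \<Prod>i\<in>S \<times> (V - S). if {fst i, snd i} \<in> E then \<alpha> (fst i) (snd i) else \<beta> (fst i) (snd i))
      = (\<Prod>i\<in>S \<times> (V - S). p * \<alpha> (fst i) (snd i) + (1 - p) * \<beta> (fst i) (snd i))"
    using assms \<open>finite S\<close>
    by (intro subset_expectation_prod) (auto simp: finite_imp_finite_nsets inj_on_def doubleton_eq_iff)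
  then show ?thesis by (simp add: prod.cartesian_product split_def)
qed

section \<open>Cutting the giant\<close>

definition neighbours :: "'a set set \<Rightarrow> 'a \<Rightarrow> 'a set" where
  "neighbours E v = {w. {v, w} \<in> E}"

definition crossing_neighbours :: "'a set set \<Rightarrow> 'a set \<Rightarrow> 'a \<Rightarrow> 'a set" where
  "crossing_neighbours E A v = {w \<in> neighbours E v. (w \<in> A) \<noteq> (v \<in> A)}"

definition cut_edges :: "'a set set \<Rightarrow> 'a set \<Rightarrow> 'a set set" where
  "cut_edges E A = {e \<in> E. e \<inter> A \<noteq> {} \<and> \<not> e \<subseteq> A}"

lemma neighbours_subset: "E \<subseteq> nsets V 2 \<Longrightarrow> neighbours E v \<subseteq> V - {v}"
  unfolding neighbours_def using doubleton_in_nsets_2[of v _ V] by blast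

lemma finite_neighbours: "E \<subseteq> nsets V 2 \<Longrightarrow> finite V \<Longrightarrow> finite (neighbours E v)"
  using neighbours_subset[of E V v] by (auto intro: finite_subset)

lemma edges_at_eq:
  assumes "E \<subseteq> nsets V 2"
  shows "{e \<in> E. v \<in> e} = (\<lambda>w. {v, w}) ` neighbours E v"
proof
  show "{e \<in> E. v \<in> e} \<subseteq> (\<lambda>w. {v, w}) ` neighbours E v"
  proof
    fix e assume e: "e \<in> {e \<in> E. v \<in> e}"
    then have "card e = 2" using assms by (auto simp: nsets_def)
    then obtain x y where "e = {x, y}" by (auto simp: card_2_iff)
    with e have "\<exists>w. e = {v, w}" by auto
    then show "e \<in> (\<lambda>w. {v, w}) ` neighbours E v" using e by (auto simp: neighbours_def)
  qed
qed (auto simp: neighbours_def)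

lemma card_doubleton_image: "card ((\<lambda>w. {v, w}) ` S) = card S"
  by (rule card_image) (auto simp: inj_on_def doubleton_eq_iff)

lemma graph_degree_eq:
  assumes "edges G \<subseteq> nsets V 2"
  shows "graph_degree G v = card (neighbours (edges G) v)"
  unfolding graph_degree_def edges_at_eq[OF assms] card_doubleton_image ..

lemma cut_edges_subset: "E \<subseteq> nsets V 2 \<Longrightarrow> cut_edges E A \<subseteq> nsets V 2"
  by (auto simp: cut_edges_def)

lemma neighbours_cut_edges: "neighbours (cut_edges E A) v = crossing_neighbours E A v"
  by (auto simp: neighbours_def cut_edges_def crossing_neighbours_def)

text \<open>Take the minimum cut among all \<open>A\<close> that agree with \<open>A\<^sub>0\<close> outside \<open>B\<close>: moving a single vertex
  of \<open>B\<close> to the other side cannot make it smaller.\<close>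

lemma exists_locally_minimal_cut:
  fixes A\<^sub>0 :: "'a set"
  assumes E: "E \<subseteq> nsets V 2" and fin: "finite V"
  obtains A where "A - B = A\<^sub>0 - B"
    and "\<And>v. v \<in> B \<Longrightarrow> 2 * card (crossing_neighbours E A v) \<le> card (neighbours E v)"
proof -
  define P where "P A \<longleftrightarrow> A - B = A\<^sub>0 - B" for A
  define A where "A = arg_min (\<lambda>A. card (cut_edges E A)) P"
  have "P A\<^sub>0" by (simp add: P_def)
  then have PA: "P A" and min: "\<And>A'. P A' \<Longrightarrow> card (cut_edges E A) \<le> card (cut_edges E A')"
    using arg_min_nat_lemma[of P A\<^sub>0 "\<lambda>A. card (cut_edges E A)"] by (auto simp: A_def)
  have finE: "finite E" using E fin by (auto intro: finite_subset finite_imp_finite_nsets)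
  show thesis
  proof (rule that[of A])
    show "A - B = A\<^sub>0 - B" using PA by (simp add: P_def)
    fix v assume v: "v \<in> B"
    define A' where "A' = (if v \<in> A then A - {v} else insert v A)"
    let ?X = "(\<lambda>w. {v, w}) ` crossing_neighbours E A v"
    let ?Y = "(\<lambda>w. {v, w}) ` (neighbours E v - crossing_neighbours E A v)"
    let ?R = "{e \<in> cut_edges E A. v \<notin> e}"
    have at_v: "{e \<in> cut_edges E A'' . v \<in> e} = (\<lambda>w. {v, w}) ` crossing_neighbours E A'' v" for A''
      using edges_at_eq[OF cut_edges_subset[OF E]] neighbours_cut_edges by metis
    \<comment> \<open>Moving \<open>v\<close> to the other side exchanges the crossing and the
      non-crossing edges at \<open>v\<close> and leaves all other edges as they were. Minimality
      therefore compares just these two numbers.\<close>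
    have flip: "crossing_neighbours E A' v = neighbours E v - crossing_neighbours E A v"
      using neighbours_subset[OF E, of v] by (auto simp: crossing_neighbours_def A'_def)
    have rest: "{e \<in> cut_edges E A'. v \<notin> e} = ?R"
      by (auto simp: cut_edges_def A'_def)
    have split: "card (cut_edges E A'') = card {e \<in> cut_edges E A''. v \<notin> e} + card (crossing_neighbours E A'' v)" for A''
    proof -
      have "cut_edges E A'' = {e \<in> cut_edges E A''. v \<notin> e} \<union> {e \<in> cut_edges E A''. v \<in> e}" by auto
      moreover have "finite (cut_edges E A'')" using finE by (simp add: cut_edges_def)
      ultimately have "card (cut_edges E A'') = card {e \<in> cut_edges E A''. v \<notin> e} + card {e \<in> cut_edges E A''. v \<in> e}"
        by (metis (no_types, lifting) card_Un_disjoint disjoint_iff finite_Un mem_Collect_eq)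
      then show ?thesis by (simp add: at_v card_doubleton_image)
    qed
    have "P A'" using PA v by (auto simp: P_def A'_def)
    then have "card (crossing_neighbours E A v) \<le> card (neighbours E v - crossing_neighbours E A v)"
      using min[of A'] split[of A] split[of A'] rest flip by simp
    moreover have "crossing_neighbours E A v \<subseteq> neighbours E v" by (auto simp: crossing_neighbours_def)
    ultimately show "2 * card (crossing_neighbours E A v) \<le> card (neighbours E v)"
      using finite_neighbours[OF E fin, of v] by (simp add: card_Diff_subset finite_subset)
  qed
qed

section \<open>Components and expansion\<close>

definition component :: "'a graph \<Rightarrow> 'a \<Rightarrow> 'a set" where
  "component G v = {u \<in> verts G. reachable G v u}"

lemma graph_components_eq: "graph_components G = component G ` verts G"
  by (auto simp: graph_components_def component_def)

lemma self_in_component: "v \<in> verts G \<Longrightarrow> v \<in> component G v"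
  by (simp add: component_def reachable_def)

lemma component_subset: "component G v \<subseteq> verts G"
  by (auto simp: component_def)

lemma neighbours_component_subset:
  assumes "edges G \<subseteq> nsets (verts G) 2" "u \<in> component G v"
  shows "neighbours (edges G) u \<subseteq> component G v"
proof
  fix w assume w: "w \<in> neighbours (edges G) u"
  then have "w \<in> verts G" using neighbours_subset[OF assms(1)] by blast
  moreover have "(u, w) \<in> {(x, y). {x, y} \<in> edges G}" using w by (simp add: neighbours_def)
  ultimately show "w \<in> component G v"
    using assms(2) by (auto simp: component_def reachable_def intro: rtrancl.rtrancl_into_rtrancl)
qed

text \<open>The \<open>SIGMA\<close> set counts every edge leaving \<open>S\<close> once. The
  property serves twice: it forces a component with at least a third of the vertices, and it
  excludes that a third of the vertices all have degree at most \<open>K\<close>.\<close>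

definition expanding :: "'a set \<Rightarrow> nat \<Rightarrow> 'a set set \<Rightarrow> bool" where
  "expanding V K E \<longleftrightarrow> (\<forall>S\<subseteq>V. card V \<le> 3 * card S \<and> 3 * card S \<le> 2 * card V \<longrightarrow>
     K * card V < card (SIGMA w:S. neighbours E w - S))"

text \<open>No edge leaves a union of components, so by expansion its size is never between one and
  two thirds of the vertices. If all components had less than a third, then joining one more to a
  largest closed set with at most two thirds would again give such a set, a contradiction.\<close>

lemma exists_large_component:
  assumes E: "edges G \<subseteq> nsets (verts G) 2" and fin: "finite (verts G)" and ne: "verts G \<noteq> {}"
    and exp: "expanding (verts G) K (edges G)"
  shows "\<exists>D\<in>graph_components G. card (verts G) \<le> 3 * card D"
proof (rule ccontr)
  assume neg: "\<not> ?thesis"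
  let ?V = "verts G"
  define closed where "closed S \<longleftrightarrow> S \<subseteq> ?V \<and> (\<forall>w\<in>S. neighbours (edges G) w \<subseteq> S)" for S
  let ?F = "{S. closed S \<and> 3 * card S \<le> 2 * card ?V}"
  have "?F \<subseteq> Pow ?V" by (auto simp: closed_def)
  then have "finite ?F" using fin by (auto intro: finite_subset)
  moreover have "{} \<in> ?F" by (simp add: closed_def)
  ultimately obtain S where S: "S \<in> ?F" and max: "\<And>T. T \<in> ?F \<Longrightarrow> card T \<le> card S"
    using obtains_MAX[of ?F card] by (metis (no_types, lifting) Max_ge empty_iff finite_imageI imageI)
  have SV: "S \<subseteq> ?V" and finS: "finite S" using S fin finite_subset by (auto simp: closed_def)
  have "(SIGMA w:S. neighbours (edges G) w - S) = {}" using S by (auto simp: closed_def)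
  then have small: "3 * card S < card ?V"
    using exp S SV unfolding expanding_def by (metis (no_types, lifting) card.empty mem_Collect_eq not_less not_less_zero)
  then have "S \<noteq> ?V" by auto
  then obtain v where v: "v \<in> ?V" "v \<notin> S" using SV by auto
  let ?T = "S \<union> component G v"
  have "3 * card (component G v) < card ?V" using neg v by (auto simp: graph_components_eq not_le)
  moreover have "card ?T \<le> card S + card (component G v)" by (rule card_Un_le)
  ultimately have "3 * card ?T \<le> 2 * card ?V" using small by linarith
  moreover have "closed ?T"
    using S component_subset[of G v] neighbours_component_subset[OF E, of _ v] unfolding closed_def by blast
  ultimately have "card ?T \<le> card S" using max by simp
  moreover have "insert v S \<subseteq> ?T" using self_in_component[OF v(1)] by auto
  then have "Suc (card S) \<le> card ?T"
    using v finS fin component_subset[of G v] by (metis card_insert_disjoint card_mono finite_Un finite_subset)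
  ultimately show False by simp
qed

text \<open>The sum of the weights over the neighbours of \<open>v\<close> is positive when those on side \<open>s\<close> are
  outnumbered by the others by more than a factor \<open>(1 + \<eta>) / (1 - \<eta>)\<close>. The slack \<open>D\<close> below makes every
  vertex of degree less than \<open>D / \<eta>\<close> unbalanced.\<close>

definition side_weight :: "real \<Rightarrow> 'a set \<Rightarrow> bool \<Rightarrow> 'a \<Rightarrow> real" where
  "side_weight \<eta> A s w = (if (w \<in> A) = s then - (1 + \<eta>) else 1 - \<eta>)"

definition unbalanced :: "real \<Rightarrow> real \<Rightarrow> 'a set \<Rightarrow> 'a set set \<Rightarrow> 'a \<Rightarrow> bool" where
  "unbalanced \<eta> D A E v \<longleftrightarrow> (\<exists>s. - D < (\<Sum>w\<in>neighbours E v. side_weight \<eta> A s w))"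

text \<open>The two bounds come from the two sides \<open>s\<close>. The first limits the crossing
  degree, so that the crossing edges may be deleted; the second makes it large, so that there is
  something to delete.\<close>

lemma not_unbalancedD:
  assumes E: "E \<subseteq> nsets V 2" and fin: "finite V" and bal: "\<not> unbalanced \<eta> D A E v"
  defines "x \<equiv> real (card (crossing_neighbours E A v))" and "d \<equiv> real (card (neighbours E v))"
  shows "2 * x \<le> (1 + \<eta>) * d - D" and "D + (1 - \<eta>) * (d - x) \<le> (1 + \<eta>) * x"
proof -
  have finN: "finite (neighbours E v)" by (rule finite_neighbours[OF E fin])
  have sub: "crossing_neighbours E A v \<subseteq> neighbours E v" by (auto simp: crossing_neighbours_def)
  have rest: "real (card (neighbours E v - crossing_neighbours E A v)) = d - x"
    using sub finN by (simp add: x_def d_def card_Diff_subset finite_subset of_nat_diff card_mono)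
  have sums: "(\<Sum>w\<in>neighbours E v. side_weight \<eta> A s w)
      = (if s = (v \<in> A) then (1 - \<eta>) * x - (1 + \<eta>) * (d - x) else (1 - \<eta>) * (d - x) - (1 + \<eta>) * x)" for s
  proof -
    have "(\<Sum>w\<in>neighbours E v. side_weight \<eta> A s w)
        = (\<Sum>w\<in>neighbours E v - crossing_neighbours E A v. side_weight \<eta> A s w)
        + (\<Sum>w\<in>crossing_neighbours E A v. side_weight \<eta> A s w)"
      using sub finN by (rule sum.subset_diff)
    also have "(\<Sum>w\<in>neighbours E v - crossing_neighbours E A v. side_weight \<eta> A s w)
        = (\<Sum>w\<in>neighbours E v - crossing_neighbours E A v. if s = (v \<in> A) then - (1 + \<eta>) else 1 - \<eta>)"
      by (intro sum.cong) (auto simp: side_weight_def crossing_neighbours_def)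
    also have "(\<Sum>w\<in>crossing_neighbours E A v. side_weight \<eta> A s w)
        = (\<Sum>w\<in>crossing_neighbours E A v. if s = (v \<in> A) then 1 - \<eta> else - (1 + \<eta>))"
      by (intro sum.cong) (auto simp: side_weight_def crossing_neighbours_def)
    finally show ?thesis by (cases "s = (v \<in> A)") (simp_all add: rest x_def[symmetric] algebra_simps)
  qed
  have "(\<Sum>w\<in>neighbours E v. side_weight \<eta> A (v \<in> A) w) \<le> - D"
    and "(\<Sum>w\<in>neighbours E v. side_weight \<eta> A (v \<notin> A) w) \<le> - D"
    using bal by (auto simp: unbalanced_def not_less)
  then show "2 * x \<le> (1 + \<eta>) * d - D" and "D + (1 - \<eta>) * (d - x) \<le> (1 + \<eta>) * x"
    by (simp_all add: sums algebra_simps)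
qed

text \<open>The deterministic core: the random graph enters only through \<open>exp\<close> and
  \<open>few\<close>. The adversary deletes the cut edges inside the giant, for a cut that is
  locally minimal on the unbalanced vertices.\<close>

lemma not_resilient_giant:
  fixes V :: "'a set" and \<eta> :: real
  assumes fin: "finite V" and V: "2 \<le> card V" and E: "E \<subseteq> nsets V 2" and \<eta>: "0 < \<eta>" "\<eta> < 1"
    and exp: "expanding V K E"
    and few: "\<And>v. v \<in> V \<Longrightarrow> card {w \<in> neighbours E v. unbalanced \<eta> (2 * K + 1) A\<^sub>0 E w} \<le> K"
    and giant: "is_giant (V, E) L"
  shows "\<not> resilient (1 / 2 + \<eta> / 2) connected_graph L"
proof -
  let ?bad = "unbalanced \<eta> (2 * K + 1) A\<^sub>0 E"
  let ?N = "neighbours E"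
  note finN = finite_neighbours[OF E fin]
  from giant obtain C where C: "C \<in> graph_components (V, E)" and L: "L = (C, {e \<in> E. e \<subseteq> C})"
    and large: "\<And>D. D \<in> graph_components (V, E) \<Longrightarrow> card D \<le> card C"
    by (auto simp: is_giant_def induced_def)
  from C obtain v\<^sub>0 where C_eq: "C = component (V, E) v\<^sub>0" by (auto simp: graph_components_eq)
  have CV: "C \<subseteq> V" and closed: "\<And>u. u \<in> C \<Longrightarrow> ?N u \<subseteq> C"
    using component_subset[of "(V, E)"] neighbours_component_subset[of "(V, E)"] E
    by (simp_all add: C_eq)
  have finC: "finite C" using CV fin finite_subset by auto
  have "V \<noteq> {}" using V by auto
  then have C3: "card V \<le> 3 * card C"
    using exists_large_component[of "(V, E)" K] E fin exp large by (force intro: order_trans)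
  have "\<exists>v\<in>C. \<not> ?bad v"
  proof (rule ccontr)
    assume "\<not> ?thesis"
    then have bad: "?bad w" if "w \<in> C" for w using that by auto
    \<comment> \<open>All neighbours of \<open>u\<close> lie in \<open>C\<close> and are thus
      unbalanced, so \<open>few\<close> bounds the whole degree.\<close>
    have deg: "card (?N u) \<le> K" if "u \<in> C" for u
    proof -
      have "{w \<in> ?N u. ?bad w} = ?N u" using closed[OF that] bad by auto
      then show ?thesis using few[of u] that CV by auto
    qed
    \<comment> \<open>A third of \<open>card V\<close>, rounded up, is the least size to which
      expansion applies; it stays below two thirds because \<open>card V \<ge> 2\<close>.\<close>
    define k where "k = (card V + 2) div 3"
    have k: "card V \<le> 3 * k" "3 * k \<le> 2 * card V" "k \<le> card C"
      using V C3 by (auto simp: k_def)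
    obtain S where S: "S \<subseteq> C" "card S = k" "finite S"
      using obtain_subset_with_card_n[OF k(3)] by blast
    have "K * card V < card (SIGMA w:S. ?N w - S)"
      using exp S CV k by (auto simp: expanding_def)
    also have "\<dots> = (\<Sum>w\<in>S. card (?N w - S))"
      using S finN by simp
    also have "\<dots> \<le> (\<Sum>w\<in>S. K)"
      using S deg finN by (intro sum_mono) (meson Diff_subset card_mono order_trans subset_iff)
    also have "\<dots> \<le> K * card V"
      using S card_mono[OF fin order_trans[OF S(1) CV]] by simp
    finally show False by simp
  qed
  then obtain v where v: "v \<in> C" "\<not> ?bad v" by auto
  obtain A where A: "A - {v. ?bad v} = A\<^sub>0 - {v. ?bad v}"
    and min: "\<And>v. ?bad v \<Longrightarrow> 2 * card (crossing_neighbours E A v) \<le> card (?N v)"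
    using exists_locally_minimal_cut[OF E fin, of "{v. ?bad v}" A\<^sub>0] by auto
  have side: "w \<in> A \<longleftrightarrow> w \<in> A\<^sub>0" if "\<not> ?bad w" for w using A that by auto
  have cross: "2 * real (card (crossing_neighbours E A u)) \<le> (1 + \<eta>) * real (card (?N u))" if u: "u \<in> V" for u
  proof (cases "?bad u")
    case True
    have "0 \<le> \<eta> * real (card (?N u))" using \<eta> by simp
    then show ?thesis using min[OF True] by (simp add: distrib_right)
  next
    case False
    \<comment> \<open>\<open>A\<close> and \<open>A\<^sub>0\<close> differ only on unbalanced
      vertices, so the crossing degree of \<open>u\<close> grows by at most \<open>K\<close>.
      Doubled, this is absorbed by the slack \<open>2 * K + 1\<close>.\<close>
    have "crossing_neighbours E A u \<subseteq> crossing_neighbours E A\<^sub>0 u \<union> {w \<in> ?N u. ?bad w}"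
      using side False by (auto simp: crossing_neighbours_def)
    then have "card (crossing_neighbours E A u) \<le> card (crossing_neighbours E A\<^sub>0 u \<union> {w \<in> ?N u. ?bad w})"
      using finN[of u] by (intro card_mono) (auto simp: crossing_neighbours_def)
    also have "\<dots> \<le> card (crossing_neighbours E A\<^sub>0 u) + K"
      using few[OF u] card_Un_le order_trans add_left_mono by meson
    finally show ?thesis using not_unbalancedD(1)[OF E fin False] by simp
  qed
  \<comment> \<open>The slack \<open>2 * K + 1\<close> gives \<open>v\<close> more than
    \<open>K\<close> crossing neighbours under \<open>A\<^sub>0\<close>. At most \<open>K\<close> of
    its neighbours are unbalanced, so one crossing neighbour keeps its side in
    \<open>A\<close>.\<close>
  obtain w where w: "w \<in> ?N v" "(w \<in> A) \<noteq> (v \<in> A)"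
  proof -
    let ?x = "real (card (crossing_neighbours E A\<^sub>0 v))"
    have "card (crossing_neighbours E A\<^sub>0 v) \<le> card (?N v)"
      using finN by (intro card_mono) (auto simp: crossing_neighbours_def)
    then have "0 \<le> (1 - \<eta>) * (real (card (?N v)) - ?x)" using \<eta> by simp
    then have "real (2 * K + 1) \<le> (1 + \<eta>) * ?x" using not_unbalancedD(2)[OF E fin v(2)] by simp
    also have "\<dots> \<le> 2 * ?x" using \<eta> by (intro mult_right_mono) auto
    finally have "K < card (crossing_neighbours E A\<^sub>0 v)" by linarith
    moreover have "card {w \<in> ?N v. ?bad w} \<le> K" using few v(1) CV by blast
    ultimately have "\<not> crossing_neighbours E A\<^sub>0 v \<subseteq> {w \<in> ?N v. ?bad w}"
      using card_mono[of "{w \<in> ?N v. ?bad w}" "crossing_neighbours E A\<^sub>0 v"] finN[of v] by auto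
    then obtain w where "w \<in> crossing_neighbours E A\<^sub>0 v" "\<not> ?bad w"
      by (auto simp: crossing_neighbours_def)
    then show thesis using side v(2) by (intro that[of w]) (auto simp: crossing_neighbours_def)
  qed
  let ?EC = "{e \<in> E. e \<subseteq> C}"
  have EC: "?EC \<subseteq> nsets V 2" using E by auto
  have NC: "neighbours ?EC u = ?N u" if "u \<in> C" for u
    using closed[OF that] that by (auto simp: neighbours_def)
  define H where "H = (C, cut_edges ?EC A)"
  have "spanning_subgraph H L" by (auto simp: H_def L spanning_subgraph_def cut_edges_def)
  moreover have "real (graph_degree H u) \<le> (1 / 2 + \<eta> / 2) * real (graph_degree L u)" if u: "u \<in> verts L" for u
  proof -
    have uC: "u \<in> C" using u L by simp
    have "graph_degree H u = card (crossing_neighbours ?EC A u)"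
      using graph_degree_eq[of H V u] cut_edges_subset[OF EC] by (simp add: H_def neighbours_cut_edges)
    also have "crossing_neighbours ?EC A u = crossing_neighbours E A u"
      by (simp add: crossing_neighbours_def NC[OF uC])
    finally have "graph_degree H u = card (crossing_neighbours E A u)" .
    moreover have "graph_degree L u = card (?N u)"
      using graph_degree_eq[of L V u] EC NC[OF uC] by (simp add: L)
    ultimately show ?thesis using cross[of u] uC CV by (auto simp: field_simps)
  qed
  moreover have "\<not> connected_graph (graph_diff L H)"
  proof
    assume con: "connected_graph (graph_diff L H)"
    have "w \<in> C" using closed[OF v(1)] w by auto
    then have "(v, w) \<in> {(x, y). {x, y} \<in> ?EC - cut_edges ?EC A}\<^sup>*"
      using con v(1) by (auto simp: connected_graph_def graph_diff_def reachable_def L H_def)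
    then have "(w \<in> A) = (v \<in> A)"
      by (induction rule: rtrancl_induct) (auto simp: cut_edges_def)
    then show False using w by simp
  qed
  ultimately show ?thesis unfolding resilient_def by blast
qed

section \<open>First-moment estimates\<close>

lemma of_bool_bex_le_sum:
  fixes f :: "'i \<Rightarrow> real"
  assumes "finite I" "\<And>i. i \<in> I \<Longrightarrow> 0 \<le> f i" "\<And>i. i \<in> I \<Longrightarrow> P i \<Longrightarrow> 1 \<le> f i"
  shows "of_bool (\<exists>i\<in>I. P i) \<le> (\<Sum>i\<in>I. f i)"
proof (cases "\<exists>i\<in>I. P i")
  case True
  then obtain i where "i \<in> I" "P i" by auto
  then show ?thesis using assms member_le_sum[of i I f] by force
qed (simp add: assms sum_nonneg)

text \<open>Links a product over potential edges, whose expectation factorizes, to the exponential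
  of a sum over the edges that are present.\<close>

lemma prod_if_exp:
  fixes c :: "'a \<Rightarrow> real"
  assumes "finite X"
  shows "(\<Prod>x\<in>X. if P x then exp (c x) else 1) = exp (\<Sum>x | x \<in> X \<and> P x. c x)"
proof -
  have "(\<Prod>x\<in>X. if P x then exp (c x) else 1) = (\<Prod>x\<in>X \<inter> {x. P x}. exp (c x))"
    using assms by (simp add: prod.If_cases)
  also have "X \<inter> {x. P x} = {x. x \<in> X \<and> P x}" by auto
  finally show ?thesis using assms by (simp add: exp_sum)
qed

text \<open>A union bound over at most \<open>2 ^ card V\<close> sets \<open>S\<close>. The number
  of edges leaving a fixed \<open>S\<close> is binomial over at least
  \<open>2 * card V ^ 2 / 9\<close> pairs, and each pair contributes at most
  \<open>exp (- (p / 2))\<close> to the exponential moment.\<close>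

lemma expectation_not_expanding_le:
  fixes V :: "'a set" and p :: real
  assumes fin: "finite V" and p: "0 \<le> p" "p \<le> 1"
  shows "subset_expectation p (nsets V 2) (\<lambda>E. of_bool (\<not> expanding V K E))
       \<le> 2 ^ card V * exp (real K * card V - p * card V ^ 2 / 9)"
proof -
  let ?n = "card V"
  define I where "I = {S. S \<subseteq> V \<and> ?n \<le> 3 * card S \<and> 3 * card S \<le> 2 * ?n}"
  \<comment> \<open>The exponential Markov weight for having at most \<open>K * card V\<close> edges
    leaving \<open>S\<close>, as a product over the pairs between \<open>S\<close> and its
    complement.\<close>
  define f where "f S E = exp (real K * ?n) * (\<Prod>w\<in>S. \<Prod>x\<in>V - S. if {w, x} \<in> E then exp (- 1) else 1)"
    for S :: "'a set" and E :: "'a set set"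
  have finI: "finite I" using fin by (auto simp: I_def)
  have "of_bool (\<not> expanding V K E) \<le> (\<Sum>S\<in>I. f S E)" if E: "E \<subseteq> nsets V 2" for E
  proof -
    have "1 \<le> f S E" if S: "S \<in> I" and few: "card (SIGMA w:S. neighbours E w - S) \<le> K * ?n" for S
    proof -
      have finS: "finite S" using S fin finite_subset by (auto simp: I_def)
      have "{x \<in> V - S. {w, x} \<in> E} = neighbours E w - S" for w
        using neighbours_subset[OF E] by (auto simp: neighbours_def)
      then have "(\<Prod>w\<in>S. \<Prod>x\<in>V - S. if {w, x} \<in> E then exp (- 1) else 1 :: real)
          = exp (- real (\<Sum>w\<in>S. card (neighbours E w - S)))"
        using fin finS by (subst prod_if_exp) (simp_all add: exp_sum flip: sum_negf)
      also have "(\<Sum>w\<in>S. card (neighbours E w - S)) = card (SIGMA w:S. neighbours E w - S)"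
        using finS finite_neighbours[OF E fin] by simp
      finally have "f S E = exp (real K * ?n - real (card (SIGMA w:S. neighbours E w - S)))"
        by (simp add: f_def exp_diff exp_minus field_simps)
      moreover have "real (card (SIGMA w:S. neighbours E w - S)) \<le> real K * ?n"
        using few by (metis of_nat_le_iff of_nat_mult)
      ultimately show ?thesis by simp
    qed
    moreover have "0 \<le> f S E" for S by (auto simp: f_def intro!: mult_nonneg_nonneg prod_nonneg)
    moreover have "\<not> expanding V K E \<longleftrightarrow> (\<exists>S\<in>I. card (SIGMA w:S. neighbours E w - S) \<le> K * ?n)"
      unfolding expanding_def I_def by (auto simp: not_less)
    ultimately show ?thesis
      by (simp only:) (intro of_bool_bex_le_sum finI; blast)
  qed
  then have "subset_expectation p (nsets V 2) (\<lambda>E. of_bool (\<not> expanding V K E))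
      \<le> subset_expectation p (nsets V 2) (\<lambda>E. \<Sum>S\<in>I. f S E)"
    using p by (intro subset_expectation_mono) auto
  also have "\<dots> = (\<Sum>S\<in>I. subset_expectation p (nsets V 2) (f S))"
    by (rule subset_expectation_sum)
  also have "\<dots> \<le> (\<Sum>S\<in>I. exp (real K * ?n - p * ?n ^ 2 / 9))"
  proof (rule sum_mono)
    fix S assume S: "S \<in> I"
    then have SV: "S \<subseteq> V" and finS: "finite S" using fin finite_subset by (auto simp: I_def)
    have q: "p * exp (- 1) + (1 - p) * 1 \<le> exp (- (p / 2))"
    proof -
      have "exp (- 1) \<le> (1 / 2 :: real)"
        using exp_ge_add_one_self[of 1] by (simp add: exp_minus field_simps)
      then have "p * exp (- 1) \<le> p * (1 / 2)" using p by (intro mult_left_mono)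
      then have "p * exp (- 1) + (1 - p) * 1 \<le> 1 + (- (p / 2))" by simp
      also have "\<dots> \<le> exp (- (p / 2))" by (rule exp_ge_add_one_self)
      finally show ?thesis .
    qed
    have "subset_expectation p (nsets V 2) (f S)
        = exp (real K * ?n) * (\<Prod>w\<in>S. \<Prod>x\<in>V - S. p * exp (- 1) + (1 - p) * 1)"
      unfolding f_def subset_expectation_cmult subset_expectation_cut_prod[OF fin SV] ..
    also have "\<dots> \<le> exp (real K * ?n) * (\<Prod>w\<in>S. \<Prod>x\<in>V - S. exp (- (p / 2)))"
      using q p by (intro mult_left_mono prod_mono conjI prod_nonneg) auto
    also have "(\<Prod>w\<in>S. \<Prod>x\<in>V - S. exp (- (p / 2))) = exp (- (p / 2 * (real (card S) * (?n - real (card S)))))"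
    proof -
      have "- (p / 2 * (real (card S) * (?n - real (card S)))) = of_nat (card S) * (of_nat (card (V - S)) * - (p / 2))"
        using SV finS fin by (simp add: card_Diff_subset of_nat_diff card_mono)
      then have "exp (- (p / 2 * (real (card S) * (?n - real (card S))))) = (exp (- (p / 2)) ^ card (V - S)) ^ card S"
        by (simp only: exp_of_nat_mult)
      then show ?thesis by simp
    qed
    also have "exp (real K * ?n) * \<dots> \<le> exp (real K * ?n - p * ?n ^ 2 / 9)"
    proof -
      define s where "s = real (card S)"
      have "real ?n \<le> real (3 * card S)" "real (3 * card S) \<le> real (2 * ?n)"
        using S unfolding of_nat_le_iff by (auto simp: I_def)
      then have "real ?n \<le> 3 * s" "3 * s \<le> 2 * real ?n" by (simp_all add: s_def)
      \<comment> \<open>The product equals \<open>9 * s * (n - s) - 2 * n ^ 2\<close> with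
        \<open>n = card V\<close>, so it is the lower bound on the number of pairs in
        disguise.\<close>
      then have "0 \<le> (3 * s - ?n) * (2 * ?n - 3 * s)" by simp
      then have "2 * real ?n ^ 2 / 9 \<le> s * (?n - s)"
        by (simp add: algebra_simps power2_eq_square)
      then have "p / 2 * (2 * real ?n ^ 2 / 9) \<le> p / 2 * (s * (?n - s))"
        using p by (intro mult_left_mono) auto
      then show ?thesis by (simp add: mult_exp_exp s_def)
    qed
    finally show "subset_expectation p (nsets V 2) (f S) \<le> exp (real K * ?n - p * ?n ^ 2 / 9)" by simp
  qed
  also have "\<dots> \<le> 2 ^ ?n * exp (real K * ?n - p * ?n ^ 2 / 9)"
  proof -
    have "card I \<le> card (Pow V)" using fin by (intro card_mono) (auto simp: I_def)
    also have "\<dots> = 2 ^ ?n" using fin by (simp add: card_Pow)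
    finally have "real (card I) \<le> real (2 ^ ?n)" by (rule of_nat_mono)
    then show ?thesis by simp
  qed
  finally show ?thesis .
qed

section \<open>Stars of unbalanced vertices\<close>

lemma side_weight_le_one: "0 \<le> \<eta> \<Longrightarrow> side_weight \<eta> A s x \<le> 1"
  by (simp add: side_weight_def)

text \<open>With exactly half of \<open>V\<close> on either side the sum would be
  \<open>- \<gamma> * card V\<close>. For odd \<open>card V\<close> the imbalance \<open>r\<close>
  of half a vertex costs at most \<open>exp \<theta>\<close>, for either \<open>s\<close>.\<close>

lemma sum_exp_side_weight_le:
  fixes V A :: "'a set"
  assumes fin: "finite V" and A: "A \<subseteq> V" "2 * card A \<le> card V" "card V \<le> 2 * card A + 1"
    and \<theta>: "0 \<le> \<theta>" and \<eta>: "0 \<le> \<eta>"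
    and \<gamma>: "exp (\<theta> * (1 - \<eta>)) + exp (- \<theta> * (1 + \<eta>)) = 2 - 2 * \<gamma>"
  shows "(\<Sum>x\<in>V. exp (\<theta> * side_weight \<eta> A s x) - 1) \<le> - \<gamma> * card V + exp \<theta>"
proof -
  define a b where "a = exp (- \<theta> * (1 + \<eta>))" and "b = exp (\<theta> * (1 - \<eta>))"
  define r where "r = real (card V) / 2 - real (card A)"
  have r: "0 \<le> r" "r \<le> 1 / 2"
    using A(2,3) unfolding r_def by linarith+
  have cards: "real (card A) = card V / 2 - r" "real (card (V - A)) = card V / 2 + r"
    using A fin by (auto simp: r_def card_Diff_subset finite_subset of_nat_diff card_mono)
  have "\<theta> * (1 - \<eta>) \<le> \<theta> * 1" using \<theta> \<eta> by (intro mult_left_mono) auto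
  then have b: "b \<le> exp \<theta>" "0 < b" by (simp_all add: b_def)
  have "- \<theta> * (1 + \<eta>) \<le> \<theta>" using \<theta> \<eta> by (simp add: algebra_simps add_nonneg_nonneg)
  then have a: "a \<le> exp \<theta>" "0 < a" by (simp_all add: a_def)
  have ab: "a + b = 2 - 2 * \<gamma>" using \<gamma> by (simp add: a_def b_def)
  have "(\<Sum>x\<in>V. exp (\<theta> * side_weight \<eta> A s x) - 1)
      = (\<Sum>x\<in>V - A. exp (\<theta> * side_weight \<eta> A s x) - 1) + (\<Sum>x\<in>A. exp (\<theta> * side_weight \<eta> A s x) - 1)"
    using A(1) fin by (rule sum.subset_diff)
  also have "(\<Sum>x\<in>V - A. exp (\<theta> * side_weight \<eta> A s x) - 1) = (\<Sum>x\<in>V - A. if s then b - 1 else a - 1)"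
    by (intro sum.cong) (auto simp: side_weight_def a_def b_def algebra_simps)
  also have "(\<Sum>x\<in>A. exp (\<theta> * side_weight \<eta> A s x) - 1) = (\<Sum>x\<in>A. if s then a - 1 else b - 1)"
    by (intro sum.cong) (auto simp: side_weight_def a_def b_def algebra_simps)
  also have "(\<Sum>x\<in>V - A. if s then b - 1 else a - 1) + (\<Sum>x\<in>A. if s then a - 1 else b - 1)
      = card V / 2 * (a + b - 2) + r * (if s then b - a else a - b)"
    by (simp add: cards field_simps)
  also have "\<dots> \<le> - \<gamma> * card V + 1 * exp \<theta>"
  proof (rule add_mono)
    show "card V / 2 * (a + b - 2) \<le> - \<gamma> * card V" by (simp add: ab)
    show "r * (if s then b - a else a - b) \<le> 1 * exp \<theta>"
    proof -
      have "r * (if s then b - a else a - b) \<le> r * exp \<theta>"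
        using r a b by (intro mult_left_mono) auto
      also have "\<dots> \<le> 1 * exp \<theta>" using r by (intro mult_right_mono) auto
      finally show ?thesis .
    qed
  qed
  finally show ?thesis by simp
qed

text \<open>A union bound over the centre \<open>v\<close>, a set \<open>W\<close> of
  \<open>K\<close> neighbours and the side on which each of them is unbalanced: at most
  \<open>n * n ^ K * 2 ^ K\<close> triples for \<open>n = card V\<close>. For a fixed triple the
  edges from \<open>W\<close> to \<open>V - W\<close> are independent. Each \<open>w\<close>
  contributes \<open>p\<close> for its edge to \<open>v\<close> and an exponential moment of order
  \<open>exp (- \<gamma> * (p * n))\<close> for the others.\<close>

lemma expectation_unbalanced_star_le:
  fixes V A :: "'a set" and p \<theta> \<eta> \<gamma> D :: real and K :: nat
  assumes fin: "finite V" and p: "0 \<le> p" "p \<le> 1"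
    and A: "A \<subseteq> V" "2 * card A \<le> card V" "card V \<le> 2 * card A + 1"
    and \<theta>: "0 \<le> \<theta>" and \<eta>: "0 \<le> \<eta>"
    and \<gamma>: "exp (\<theta> * (1 - \<eta>)) + exp (- \<theta> * (1 + \<eta>)) = 2 - 2 * \<gamma>"
  shows "subset_expectation p (nsets V 2)
           (\<lambda>E. of_bool (\<exists>v\<in>V. K \<le> card {w \<in> neighbours E v. unbalanced \<eta> D A E w}))
       \<le> card V * (2 * exp (\<theta> * (D + K) + \<theta> + exp \<theta> + K + 1) * (p * card V) * exp (- \<gamma> * (p * card V))) ^ K"
proof -
  let ?n = "card V" and ?c = "side_weight \<eta> A"
  define I where "I = (SIGMA v:V. SIGMA W:{W. W \<subseteq> V - {v} \<and> card W = K}. Pow W)"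
  \<comment> \<open>The exponential Markov weight, as a product over the pairs between
    \<open>W\<close> and \<open>V - W\<close>. An absent pair \<open>{w, v}\<close> gives the factor
    0, so adjacency of \<open>v\<close> to all of \<open>W\<close> is built in.\<close>
  define f where "f = (\<lambda>(v, W, S) E. exp (\<theta> * (D + K)) ^ K *
      (\<Prod>w\<in>W. \<Prod>x\<in>V - W. if {w, x} \<in> E then exp (\<theta> * ?c (w \<in> S) x) else of_bool (x \<noteq> v)))"
  have finW: "finite {W. W \<subseteq> V - {v} \<and> card W = K}" for v using fin by auto
  have finPow: "finite (Pow W)" if "W \<in> {W. W \<subseteq> V - {v} \<and> card W = K}" for v W
    using that fin by (auto intro: finite_subset)
  have finI: "finite I" unfolding I_def using fin finW finPow by (intro finite_SigmaI) auto
  \<comment> \<open>\<open>S\<close> records for each \<open>w \<in> W\<close> a side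
    \<open>s\<close> witnessing that \<open>w\<close> is unbalanced: \<open>True\<close> exactly on
    \<open>S\<close>.\<close>
  define Q where "Q E = (\<lambda>(v, W, S). W \<subseteq> neighbours E v \<and> (\<forall>w\<in>W. - D < (\<Sum>x\<in>neighbours E w. ?c (w \<in> S) x)))" for E
  have "of_bool (\<exists>v\<in>V. K \<le> card {w \<in> neighbours E v. unbalanced \<eta> D A E w}) \<le> (\<Sum>i\<in>I. f i E)"
    if E: "E \<subseteq> nsets V 2" for E
  proof -
    have "\<exists>i\<in>I. Q E i" if v: "v \<in> V" and large: "K \<le> card {w \<in> neighbours E v. unbalanced \<eta> D A E w}" for v
    proof -
      obtain W where W: "W \<subseteq> {w \<in> neighbours E v. unbalanced \<eta> D A E w}" "card W = K"
        using obtain_subset_with_card_n[OF large] by blast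
      define S where "S = {w \<in> W. - D < (\<Sum>x\<in>neighbours E w. ?c True x)}"
      have "- D < (\<Sum>x\<in>neighbours E w. ?c (w \<in> S) x)" if w: "w \<in> W" for w
      proof -
        have "unbalanced \<eta> D A E w" using W w by auto
        then obtain s where s: "- D < (\<Sum>x\<in>neighbours E w. ?c s x)" by (auto simp: unbalanced_def)
        show ?thesis
        proof (cases "w \<in> S")
          case False
          with s w have "\<not> s" by (cases s) (auto simp: S_def)
          with s False show ?thesis by simp
        qed (simp add: S_def)
      qed
      moreover have "(v, W, S) \<in> I"
        using v W neighbours_subset[OF E, of v] by (auto simp: I_def S_def)
      ultimately show ?thesis using W by (intro bexI[of _ "(v, W, S)"]) (auto simp: Q_def)
    qed
    then have "of_bool (\<exists>v\<in>V. K \<le> card {w \<in> neighbours E v. unbalanced \<eta> D A E w})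
        \<le> (of_bool (\<exists>i\<in>I. Q E i) :: real)" by auto
    also have "\<dots> \<le> (\<Sum>i\<in>I. f i E)"
    proof (rule of_bool_bex_le_sum[OF finI])
      fix i assume i: "i \<in> I"
      show "0 \<le> f i E" by (auto simp: f_def split_def intro!: mult_nonneg_nonneg prod_nonneg)
      assume q: "Q E i"
      obtain v W S where ivWS: "i = (v, W, S)" by (cases i)
      have v: "v \<in> V" and W: "W \<subseteq> V - {v}" "card W = K" and S: "S \<subseteq> W"
        using i by (auto simp: ivWS I_def)
      have nb: "W \<subseteq> neighbours E v" and heavy: "\<And>w. w \<in> W \<Longrightarrow> - D < (\<Sum>x\<in>neighbours E w. ?c (w \<in> S) x)"
        using q by (auto simp: ivWS Q_def)
      have "finite W" using W fin finite_subset by blast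
      have row: "exp (- (\<theta> * (D + K)))
          \<le> (\<Prod>x\<in>V - W. if {w, x} \<in> E then exp (\<theta> * ?c (w \<in> S) x) else of_bool (x \<noteq> v))" if w: "w \<in> W" for w
      proof -
        have "{w, v} \<in> E" using nb w by (auto simp: neighbours_def insert_commute)
        then have "(\<Prod>x\<in>V - W. if {w, x} \<in> E then exp (\<theta> * ?c (w \<in> S) x) else of_bool (x \<noteq> v))
            = (\<Prod>x\<in>V - W. if {w, x} \<in> E then exp (\<theta> * ?c (w \<in> S) x) else 1)"
          by (intro prod.cong) auto
        also have "\<dots> = exp (\<Sum>x | x \<in> V - W \<and> {w, x} \<in> E. \<theta> * ?c (w \<in> S) x)"
          using fin by (intro prod_if_exp) auto
        also have "{x. x \<in> V - W \<and> {w, x} \<in> E} = neighbours E w - W"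
          using neighbours_subset[OF E] by (auto simp: neighbours_def)
        finally have eq: "(\<Prod>x\<in>V - W. if {w, x} \<in> E then exp (\<theta> * ?c (w \<in> S) x) else of_bool (x \<noteq> v))
            = exp (\<theta> * (\<Sum>x\<in>neighbours E w - W. ?c (w \<in> S) x))"
          by (simp add: sum_distrib_left)
        \<comment> \<open>Edges inside \<open>W\<close> would spoil independence. Dropping them
          changes the sum by at most \<open>K\<close>, which turns the threshold \<open>- D\<close>
          into \<open>- (D + K)\<close>.\<close>
        have "(\<Sum>x\<in>neighbours E w. ?c (w \<in> S) x)
            = (\<Sum>x\<in>neighbours E w - W. ?c (w \<in> S) x) + (\<Sum>x\<in>neighbours E w \<inter> W. ?c (w \<in> S) x)"
          using finite_neighbours[OF E fin, of w] by (metis add.commute sum.Int_Diff)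
        also have "(\<Sum>x\<in>neighbours E w \<inter> W. ?c (w \<in> S) x) \<le> (\<Sum>x\<in>neighbours E w \<inter> W. 1)"
          by (intro sum_mono side_weight_le_one \<eta>)
        also have "\<dots> \<le> real K" using \<open>finite W\<close> W by (auto intro: card_mono)
        finally have "- (D + K) \<le> (\<Sum>x\<in>neighbours E w - W. ?c (w \<in> S) x)"
          using heavy[OF w] by simp
        then have "\<theta> * (- (D + K)) \<le> \<theta> * (\<Sum>x\<in>neighbours E w - W. ?c (w \<in> S) x)"
          using \<theta> by (rule mult_left_mono)
        then show ?thesis unfolding eq by (simp add: algebra_simps)
      qed
      have "1 = exp (\<theta> * (D + K)) ^ K * (\<Prod>w\<in>W. exp (- (\<theta> * (D + K))))"
        by (simp add: W exp_minus power_mult_distrib[symmetric])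
      also have "\<dots> \<le> f i E"
        unfolding ivWS f_def split_conv using row by (intro mult_left_mono prod_mono conjI) auto
      finally show "1 \<le> f i E" .
    qed
    finally show ?thesis .
  qed
  then have "subset_expectation p (nsets V 2)
        (\<lambda>E. of_bool (\<exists>v\<in>V. K \<le> card {w \<in> neighbours E v. unbalanced \<eta> D A E w}))
      \<le> subset_expectation p (nsets V 2) (\<lambda>E. \<Sum>i\<in>I. f i E)"
    using p by (intro subset_expectation_mono) auto
  also have "\<dots> = (\<Sum>i\<in>I. subset_expectation p (nsets V 2) (f i))"
    by (rule subset_expectation_sum)
  also have "\<dots> \<le> (\<Sum>i\<in>I. (exp (\<theta> * (D + K) + \<theta> + exp \<theta> + K + 1) * p * exp (- \<gamma> * (p * ?n))) ^ K)"
  proof (rule sum_mono)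
    fix i assume i: "i \<in> I"
    obtain v W S where ivWS: "i = (v, W, S)" by (cases i)
    have v: "v \<in> V" and W: "W \<subseteq> V - {v}" "card W = K" using i by (auto simp: ivWS I_def)
    have WV: "W \<subseteq> V" using W by auto
    have "finite W" using WV fin finite_subset by blast
    have row: "(\<Prod>x\<in>V - W. p * exp (\<theta> * ?c s x) + (1 - p) * of_bool (x \<noteq> v))
        \<le> exp (\<theta> + exp \<theta> + K + 1) * p * exp (- \<gamma> * (p * ?n))" for s
    proof -
      let ?X = "V - W - {v}"
      define d where "d x = exp (\<theta> * ?c s x) - 1" for x
      have d: "- 1 \<le> d x" for x by (simp add: d_def)
      \<comment> \<open>At \<open>x = v\<close> the summand for an absent edge vanishes; this is
        where the factor \<open>p\<close> appears.\<close>
      have "(\<Prod>x\<in>V - W. p * exp (\<theta> * ?c s x) + (1 - p) * of_bool (x \<noteq> v))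
          = p * exp (\<theta> * ?c s v) * (\<Prod>x\<in>?X. p * exp (\<theta> * ?c s x) + (1 - p) * of_bool (x \<noteq> v))"
        using v W fin by (subst prod.remove[of _ v]) auto
      also have "(\<Prod>x\<in>?X. p * exp (\<theta> * ?c s x) + (1 - p) * of_bool (x \<noteq> v)) = (\<Prod>x\<in>?X. 1 + p * d x)"
        by (intro prod.cong) (auto simp: d_def algebra_simps)
      also have "p * exp (\<theta> * ?c s v) * (\<Prod>x\<in>?X. 1 + p * d x) \<le> p * exp \<theta> * exp (p * (\<Sum>x\<in>?X. d x))"
      proof (intro mult_mono mult_left_mono)
        have "\<theta> * ?c s v \<le> \<theta> * 1" using \<theta> side_weight_le_one[OF \<eta>] by (intro mult_left_mono)
        then show "exp (\<theta> * ?c s v) \<le> exp \<theta>" by simp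
        have nn: "0 \<le> 1 + p * d x" for x
        proof -
          have "p * (- 1) \<le> p * d x" using p d by (intro mult_left_mono)
          then show ?thesis using p by simp
        qed
        then show "0 \<le> (\<Prod>x\<in>?X. 1 + p * d x)" by (intro prod_nonneg) auto
        have "(\<Prod>x\<in>?X. 1 + p * d x) \<le> (\<Prod>x\<in>?X. exp (p * d x))"
          using nn exp_ge_add_one_self by (intro prod_mono) auto
        also have "\<dots> = exp (p * (\<Sum>x\<in>?X. d x))" using fin by (simp add: exp_sum sum_distrib_left)
        finally show "(\<Prod>x\<in>?X. 1 + p * d x) \<le> exp (p * (\<Sum>x\<in>?X. d x))" .
      qed (use p in auto)
      also have "\<dots> \<le> p * exp \<theta> * exp (- \<gamma> * (p * ?n) + exp \<theta> + K + 1)"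
      proof -
        \<comment> \<open>The sum over all of \<open>V\<close> is under control, and each of the
          \<open>K + 1\<close> omitted terms is at least \<open>- 1\<close>.\<close>
        have "(\<Sum>x\<in>V. d x) = (\<Sum>x\<in>?X. d x) + (\<Sum>x\<in>insert v W. d x)"
        proof -
          have "?X = V - insert v W" by auto
          then show ?thesis using v WV fin by (simp only:) (intro sum.subset_diff; auto)
        qed
        moreover have "(\<Sum>x\<in>insert v W. - 1) \<le> (\<Sum>x\<in>insert v W. d x)" by (intro sum_mono d)
        then have "- (real K + 1) \<le> (\<Sum>x\<in>insert v W. d x)"
        proof -
          have "v \<notin> W" using W by auto
          then show ?thesis
            using \<open>(\<Sum>x\<in>insert v W. - 1) \<le> (\<Sum>x\<in>insert v W. d x)\<close> W \<open>finite W\<close> by simp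
        qed
        ultimately have "(\<Sum>x\<in>?X. d x) \<le> (- \<gamma> * ?n + exp \<theta>) + (K + 1)"
          using sum_exp_side_weight_le[OF fin A \<theta> \<eta> \<gamma>, of s] by (simp add: d_def)
        then have "p * (\<Sum>x\<in>?X. d x) \<le> p * (- \<gamma> * ?n + (exp \<theta> + K + 1))"
          using p by (intro mult_left_mono) auto
        also have "\<dots> = - \<gamma> * (p * ?n) + p * (exp \<theta> + K + 1)" by (simp add: algebra_simps)
        also have "p * (exp \<theta> + K + 1) \<le> 1 * (exp \<theta> + K + 1)"
          using p by (intro mult_right_mono) auto
        finally show ?thesis using p by (intro mult_left_mono) auto
      qed
      also have "\<dots> = exp (\<theta> + exp \<theta> + K + 1) * p * exp (- \<gamma> * (p * ?n))"
        by (simp only: add.assoc exp_add) (simp only: mult_ac)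
      finally show ?thesis .
    qed
    have "subset_expectation p (nsets V 2) (f i) = exp (\<theta> * (D + K)) ^ K *
        (\<Prod>w\<in>W. \<Prod>x\<in>V - W. p * exp (\<theta> * ?c (w \<in> S) x) + (1 - p) * of_bool (x \<noteq> v))"
      unfolding ivWS f_def split_conv subset_expectation_cmult subset_expectation_cut_prod[OF fin WV] ..
    also have "\<dots> \<le> exp (\<theta> * (D + K)) ^ K * (\<Prod>w\<in>W. exp (\<theta> + exp \<theta> + K + 1) * p * exp (- \<gamma> * (p * ?n)))"
    proof (intro mult_left_mono prod_mono conjI prod_nonneg row)
      show "0 \<le> p * exp (\<theta> * ?c (w \<in> S) x) + (1 - p) * of_bool (x \<noteq> v)" for w x
        using p by (intro add_nonneg_nonneg mult_nonneg_nonneg) auto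
    qed simp
    also have "\<dots> = (exp (\<theta> * (D + K) + \<theta> + exp \<theta> + K + 1) * p * exp (- \<gamma> * (p * ?n))) ^ K"
    proof -
      have "exp (\<theta> * (D + K)) * (exp (\<theta> + exp \<theta> + K + 1) * p * exp (- \<gamma> * (p * ?n)))
          = exp (\<theta> * (D + K) + \<theta> + exp \<theta> + K + 1) * p * exp (- \<gamma> * (p * ?n))"
        by (simp only: add.assoc exp_add mult.assoc)
      then show ?thesis by (simp only: prod_constant W power_mult_distrib[symmetric])
    qed
    finally show "subset_expectation p (nsets V 2) (f i)
        \<le> (exp (\<theta> * (D + K) + \<theta> + exp \<theta> + K + 1) * p * exp (- \<gamma> * (p * ?n))) ^ K" .
  qed
  also have "\<dots> = card I * (exp (\<theta> * (D + K) + \<theta> + exp \<theta> + K + 1) * p * exp (- \<gamma> * (p * ?n))) ^ K"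
    by simp
  also have "\<dots> \<le> (?n * ?n ^ K * 2 ^ K) * (exp (\<theta> * (D + K) + \<theta> + exp \<theta> + K + 1) * p * exp (- \<gamma> * (p * ?n))) ^ K"
  proof (rule mult_right_mono)
    have "card I = (\<Sum>v\<in>V. \<Sum>W\<in>{W. W \<subseteq> V - {v} \<and> card W = K}. card (Pow W))"
      unfolding I_def using fin finW finPow
      by (subst card_SigmaI) (auto intro!: sum.cong card_SigmaI finite_SigmaI)
    also have "\<dots> \<le> (\<Sum>v\<in>V. ?n ^ K * 2 ^ K)"
    proof (rule sum_mono)
      fix v assume "v \<in> V"
      have "(\<Sum>W\<in>{W. W \<subseteq> V - {v} \<and> card W = K}. card (Pow W)) = ((?n - 1) choose K) * 2 ^ K"
      proof -
        have "card (Pow W) = 2 ^ K" if "W \<in> {W. W \<subseteq> V - {v} \<and> card W = K}" for W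
          using that fin by (auto simp: card_Pow finite_subset)
        then show ?thesis using fin \<open>v \<in> V\<close> by (simp add: n_subsets)
      qed
      also have "(?n - 1) choose K \<le> (?n - 1) ^ K"
        using binomial_le_pow[of K "?n - 1"] by (cases "K \<le> ?n - 1") (auto simp: binomial_eq_0)
      also have "\<dots> \<le> ?n ^ K" by (intro power_mono) auto
      finally show "(\<Sum>W\<in>{W. W \<subseteq> V - {v} \<and> card W = K}. card (Pow W)) \<le> ?n ^ K * 2 ^ K" by simp
    qed
    finally have "card I \<le> ?n * ?n ^ K * 2 ^ K" by simp
    then show "real (card I) \<le> real (?n * ?n ^ K * 2 ^ K)" by (rule of_nat_mono)
  qed (use p in auto)
  also have "\<dots> = ?n * (2 * exp (\<theta> * (D + K) + \<theta> + exp \<theta> + K + 1) * (p * ?n) * exp (- \<gamma> * (p * ?n))) ^ K"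
  proof -
    have "a * a ^ K * 2 ^ K * (b * p * e) ^ K = a * (2 * b * (p * a) * e) ^ K" for a b e :: real
      by (simp add: power_mult_distrib mult_ac)
    then show ?thesis by (simp only: of_nat_mult of_nat_power of_nat_numeral)
  qed
  finally show ?thesis .
qed

section \<open>The limit\<close>

text \<open>At \<open>\<theta> = 0\<close> the value is 2 and the derivative is
  \<open>- 2 * \<eta>\<close>, since the weights \<open>1 - \<eta>\<close> and
  \<open>- (1 + \<eta>)\<close> have mean \<open>- \<eta>\<close>.\<close>

lemma exists_negative_tilt:
  fixes \<eta> :: real
  assumes "0 < \<eta>"
  obtains \<theta> where "0 < \<theta>" "exp (\<theta> * (1 - \<eta>)) + exp (- \<theta> * (1 + \<eta>)) < 2"
proof -
  have "((\<lambda>\<theta>. exp (\<theta> * (1 - \<eta>)) + exp (- \<theta> * (1 + \<eta>))) has_real_derivative - 2 * \<eta>) (at 0)"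
    by (auto intro!: derivative_eq_intros)
  then have "\<exists>d>0. \<forall>h>0. h < d \<longrightarrow>
      exp ((0 + h) * (1 - \<eta>)) + exp (- (0 + h) * (1 + \<eta>)) < exp (0 * (1 - \<eta>)) + exp (- 0 * (1 + \<eta>))"
    using assms by (intro DERIV_neg_dec_right) auto
  then obtain d where d: "0 < d"
    "\<And>h. 0 < h \<Longrightarrow> h < d \<Longrightarrow> exp (h * (1 - \<eta>)) + exp (- h * (1 + \<eta>)) < 2" by auto
  show thesis by (rule that[OF _ d(2)[of "d / 2"]]) (use d(1) in auto)
qed

lemma real_choose_two:
  "real (n choose 2) = real n * (real n - 1) / 2"
  by (cases n) (simp_all add: choose_two real_of_nat_div algebra_simps)

text \<open>Bounds both the loss in passing to the binomial model and the number of times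
  \<open>m\<close> in the union bound.\<close>

lemma choose_two_plus_one_le:
  assumes "2 \<le> n"
  shows "real ((n choose 2) + 1) \<le> real n ^ 2"
proof -
  have "0 \<le> (real n - 1) * (real n + 2)" using assms by simp
  then show ?thesis by (simp add: real_choose_two power2_eq_square field_simps)
qed

text \<open>The bound for a single time. The constants \<open>K\<close> and \<open>C\<close> are
  uniform in \<open>n\<close> and \<open>m\<close>, and the power \<open>n ^ 5\<close> leaves room
  for the factor \<open>n ^ 2\<close> here and another one from the union over
  \<open>m\<close>.\<close>

lemma prob_resilient_giant_le:
  fixes \<eta> :: real
  assumes \<eta>: "0 < \<eta>" "\<eta> < 1"
  obtains K C :: real where
    "\<And>n m. 2 \<le> n \<Longrightarrow> m \<le> n choose 2 \<Longrightarrow> real n * ln (real n) / 6 \<le> real m \<Longrightarrow>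
       measure_pmf.prob (random_graph_process n)
         {Gs. \<exists>L. is_giant (Gs ! m) L \<and> resilient (1 / 2 + \<eta> / 2) connected_graph L}
       \<le> real n ^ 2 * (C / real n ^ 5 + exp (real n * (K - ln (real n) / 27)))"
proof -
  obtain \<theta> where \<theta>: "0 < \<theta>" "exp (\<theta> * (1 - \<eta>)) + exp (- \<theta> * (1 + \<eta>)) < 2"
    using exists_negative_tilt[OF \<eta>(1)] by blast
  define \<gamma> where "\<gamma> = 1 - (exp (\<theta> * (1 - \<eta>)) + exp (- \<theta> * (1 + \<eta>))) / 2"
  have \<gamma>: "0 < \<gamma>" "exp (\<theta> * (1 - \<eta>)) + exp (- \<theta> * (1 + \<eta>)) = 2 - 2 * \<gamma>"
    using \<theta>(2) by (simp_all add: \<gamma>_def field_simps)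
  \<comment> \<open>Each of the \<open>K\<close> neighbours will contribute
    \<open>exp (- (\<gamma> / 6 * ln n))\<close>; with \<open>\<gamma> * K \<ge> 36\<close> the
    product is at most \<open>1 / n ^ 6\<close>.\<close>
  obtain K :: nat where "36 / \<gamma> \<le> real K" using real_arch_simple by blast
  then have K: "36 \<le> \<gamma> * real K" using \<gamma> by (simp add: field_simps)
  define D where "D = real (2 * K + 1)"
  define c where "c = 2 * exp (\<theta> * (D + K) + \<theta> + exp \<theta> + K + 1)"
  define C where "C = (2 * c / \<gamma>) ^ K"
  have c: "0 < c" by (simp add: c_def)
  show thesis
  proof (rule that[of C "real K + 1"])
    fix n m :: nat
    assume n: "2 \<le> n" and m: "m \<le> n choose 2" "real n * ln (real n) / 6 \<le> real m"
    let ?V = "{..<n}" and ?A = "{..<n div 2}" and ?N = "n choose 2"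
    define p where "p = real m / real ?N"
    define x where "x = p * n"
    define good where "good E \<longleftrightarrow> expanding ?V K E \<and>
      \<not> (\<exists>v\<in>?V. K \<le> card {w \<in> neighbours E v. unbalanced \<eta> D ?A E w})" for E
    have Npos: "0 < ?N" using n by simp
    have p: "0 \<le> p" "p \<le> 1" using m Npos by (auto simp: p_def divide_le_eq simp del: binomial_eq_0_iff zero_less_binomial_iff)
    have x: "ln n / 3 \<le> x"
    proof -
      have "x = 2 * real m / (real n - 1)" using n by (simp add: x_def p_def real_choose_two field_simps)
      moreover have "2 * real m / real n \<le> 2 * real m / (real n - 1)"
        using n by (intro divide_left_mono) auto
      moreover have "ln n / 3 \<le> 2 * real m / real n" using m(2) n by (simp add: field_simps)
      ultimately show ?thesis by linarith
    qed
    have K_nsets: "finite (nsets ?V 2)" "card (nsets ?V 2) = ?N" by (simp_all add: finite_imp_finite_nsets)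
    have star: "subset_expectation p (nsets ?V 2)
        (\<lambda>E. of_bool (\<exists>v\<in>?V. K \<le> card {w \<in> neighbours E v. unbalanced \<eta> D ?A E w})) \<le> C / real n ^ 5"
    proof -
      have "subset_expectation p (nsets ?V 2)
          (\<lambda>E. of_bool (\<exists>v\<in>?V. K \<le> card {w \<in> neighbours E v. unbalanced \<eta> D ?A E w}))
          \<le> n * (c * x * exp (- \<gamma> * x)) ^ K"
        using expectation_unbalanced_star_le[of ?V p ?A \<theta> \<eta> \<gamma> K D] p \<theta> \<eta> \<gamma> by (simp add: c_def x_def)
      also have "\<dots> \<le> n * (2 * c / \<gamma> * exp (- (\<gamma> / 6 * ln n))) ^ K"
      proof (intro mult_left_mono power_mono)
        \<comment> \<open>Half of the exponent is spent on the polynomial factor \<open>x\<close>,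
          by \<open>y \<le> exp y\<close> with \<open>y = \<gamma> * x / 2\<close>.\<close>
        have "\<gamma> * x / 2 \<le> exp (\<gamma> * x / 2)" using exp_ge_add_one_self[of "\<gamma> * x / 2"] by linarith
        then have "2 * c / \<gamma> * (\<gamma> * x / 2) * exp (- \<gamma> * x) \<le> 2 * c / \<gamma> * exp (\<gamma> * x / 2) * exp (- \<gamma> * x)"
          using c \<gamma> by (intro mult_right_mono mult_left_mono) auto
        also have "\<dots> = 2 * c / \<gamma> * exp (- (\<gamma> / 2 * x))" by (simp add: mult_exp_exp)
        also have "\<dots> \<le> 2 * c / \<gamma> * exp (- (\<gamma> / 2 * (ln n / 3)))"
          using c \<gamma> x by (intro mult_left_mono) auto
        finally show "c * x * exp (- \<gamma> * x) \<le> 2 * c / \<gamma> * exp (- (\<gamma> / 6 * ln n))"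
          using \<gamma> by simp
        have "0 \<le> x" using x n ln_ge_zero[of "real n"] by linarith
        then show "0 \<le> c * x * exp (- \<gamma> * x)" using c by simp
      qed simp
      also have "\<dots> = n * (C * exp (- (\<gamma> * K / 6 * ln n)))"
      proof -
        have "- (\<gamma> * K / 6 * ln n) = of_nat K * - (\<gamma> / 6 * ln n)" by simp
        then show ?thesis by (simp only: C_def power_mult_distrib exp_of_nat_mult)
      qed
      also have "\<dots> \<le> n * (C * exp (- (6 * ln n)))"
      proof -
        have "6 * ln n \<le> \<gamma> * K / 6 * ln n" using K n by (intro mult_right_mono) auto
        then show ?thesis using c \<gamma> by (intro mult_left_mono) (auto simp: C_def)
      qed
      also have "exp (- (6 * ln n)) = 1 / real n ^ 6"
      proof -
        have "exp (6 * ln (real n)) = exp (ln (real n)) ^ 6" by (metis exp_of_nat_mult of_nat_numeral)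
        then show ?thesis using n by (simp add: exp_minus inverse_eq_divide)
      qed
      also have "n * (C * (1 / real n ^ 6)) = C / real n ^ 5"
        using n by (simp add: field_simps power_numeral_reduce)
      finally show ?thesis .
    qed
    have expand: "subset_expectation p (nsets ?V 2) (\<lambda>E. of_bool (\<not> expanding ?V K E))
        \<le> exp (real n * (real K + 1 - ln n / 27))"
    proof -
      have "subset_expectation p (nsets ?V 2) (\<lambda>E. of_bool (\<not> expanding ?V K E))
          \<le> 2 ^ n * exp (real K * n - p * n ^ 2 / 9)"
        using expectation_not_expanding_le[of ?V p K] p by simp
      \<comment> \<open>The union over \<open>2 ^ n\<close> sets costs at most \<open>exp n\<close>,
        which makes \<open>K + 1\<close> out of \<open>K\<close>.\<close>
      also have "\<dots> \<le> exp (real n) * exp (real K * n - ln n / 27 * n)"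
      proof (rule mult_mono)
        have "(2 :: real) ^ n \<le> exp 1 ^ n" using exp_ge_add_one_self[of 1] by (intro power_mono) auto
        then show "(2 :: real) ^ n \<le> exp (real n)" by (simp flip: exp_of_nat_mult)
        have "ln n / 3 * (n / 9) \<le> x * (n / 9)" using x by (intro mult_right_mono) auto
        then show "exp (real K * n - p * n ^ 2 / 9) \<le> exp (real K * n - ln n / 27 * n)"
          by (simp add: x_def power2_eq_square)
      qed auto
      also have "\<dots> = exp (real n * (real K + 1 - ln n / 27))"
        by (simp add: mult_exp_exp algebra_simps)
      finally show ?thesis .
    qed
    have bad: "\<not> good E" if "E \<subseteq> nsets ?V 2" "is_giant (?V, E) L" "resilient (1 / 2 + \<eta> / 2) connected_graph L" for E L
    proof
      assume "good E"
      then have "\<not> resilient (1 / 2 + \<eta> / 2) connected_graph L"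
        using n \<eta> that(1,2) by (intro not_resilient_giant[of ?V E \<eta> K ?A]) (auto simp: good_def D_def not_le less_imp_le)
      then show False using that(3) by simp
    qed
    have "measure_pmf.prob (random_graph_process n)
        {Gs. \<exists>L. is_giant (Gs ! m) L \<and> resilient (1 / 2 + \<eta> / 2) connected_graph L}
        \<le> real (?N + 1) * subset_expectation p (nsets ?V 2)
            (\<lambda>E. of_bool (\<exists>L. is_giant (?V, E) L \<and> resilient (1 / 2 + \<eta> / 2) connected_graph L))"
      using uniform_le_subset_expectation[OF K_nsets(1), of m
          "\<lambda>E. \<exists>L. is_giant (?V, E) L \<and> resilient (1 / 2 + \<eta> / 2) connected_graph L"] m(1)
      unfolding prob_random_graph_process_nth[OF m(1), of
          "\<lambda>G. \<exists>L. is_giant G L \<and> resilient (1 / 2 + \<eta> / 2) connected_graph L"] K_nsets p_def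
      by simp
    also have "\<dots> \<le> real (?N + 1) * subset_expectation p (nsets ?V 2)
        (\<lambda>E. of_bool (\<exists>v\<in>?V. K \<le> card {w \<in> neighbours E v. unbalanced \<eta> D ?A E w})
          + of_bool (\<not> expanding ?V K E))"
    proof (intro mult_left_mono subset_expectation_mono p)
      fix E assume E: "E \<subseteq> nsets ?V 2"
      have "(\<exists>L. is_giant (?V, E) L \<and> resilient (1 / 2 + \<eta> / 2) connected_graph L) \<Longrightarrow> \<not> good E"
        using bad[OF E] by blast
      then show "of_bool (\<exists>L. is_giant (?V, E) L \<and> resilient (1 / 2 + \<eta> / 2) connected_graph L)
          \<le> (of_bool (\<exists>v\<in>?V. K \<le> card {w \<in> neighbours E v. unbalanced \<eta> D ?A E w})
          + of_bool (\<not> expanding ?V K E) :: real)"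
        by (auto simp: good_def simp del: lessThan_iff)
    qed simp
    also have "\<dots> \<le> real n ^ 2 * (C / real n ^ 5 + exp (real n * (real K + 1 - ln (real n) / 27)))"
      unfolding subset_expectation_add
    proof (intro mult_mono add_mono star expand add_nonneg_nonneg)
      show "real (?N + 1) \<le> real n ^ 2" by (rule choose_two_plus_one_le[OF n])
    qed (use p in \<open>auto simp: subset_expectation_def intro!: sum_nonneg\<close>)
    finally show "measure_pmf.prob (random_graph_process n)
        {Gs. \<exists>L. is_giant (Gs ! m) L \<and> resilient (1 / 2 + \<eta> / 2) connected_graph L}
        \<le> real n ^ 2 * (C / real n ^ 5 + exp (real n * (real K + 1 - ln (real n) / 27)))" .
  qed
qed

lemma resilient_antimono:
  assumes "\<beta> \<le> \<alpha>" "resilient \<alpha> P G"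
  shows "resilient \<beta> P G"
  unfolding resilient_def
proof (intro allI impI, elim conjE)
  fix H assume H: "spanning_subgraph H G" "\<forall>v\<in>verts G. real (graph_degree H v) \<le> \<beta> * real (graph_degree G v)"
  have "\<beta> * real (graph_degree G v) \<le> \<alpha> * real (graph_degree G v)" for v
    using assms(1) by (intro mult_right_mono) auto
  then show "P (graph_diff G H)"
    using assms(2) H unfolding resilient_def by (meson order_trans)
qed

theorem proposition3p4:
  fixes \<epsilon> :: real and m\<^sub>0 :: "nat \<Rightarrow> nat"
  assumes "\<epsilon> > 0"
    and "\<forall>\<^sub>F n in sequentially.
           (1 + \<epsilon>) / 6 * real n * ln (real n) \<le> real (m\<^sub>0 n) \<and> m\<^sub>0 n \<le> n choose 2"
  shows "(\<lambda>n. measure_pmf.prob (random_graph_process n)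
            {Gs. \<forall>m. m\<^sub>0 n \<le> m \<and> real m \<le> (1 + \<epsilon> / 6) * real (m\<^sub>0 n) \<and> m \<le> n choose 2 \<longrightarrow>
                   (\<forall>L. is_giant (Gs ! m) L \<longrightarrow> \<not> resilient (1 / 2 + \<epsilon>) connected_graph L)})
         \<longlonglongrightarrow> 1"
proof -
  let ?good = "\<lambda>n. {Gs. \<forall>m. m\<^sub>0 n \<le> m \<and> real m \<le> (1 + \<epsilon> / 6) * real (m\<^sub>0 n) \<and> m \<le> n choose 2 \<longrightarrow>
                   (\<forall>L. is_giant (Gs ! m) L \<longrightarrow> \<not> resilient (1 / 2 + \<epsilon>) connected_graph L)}"
  let ?P = "\<lambda>n. measure_pmf.prob (random_graph_process n)"
  \<comment> \<open>The cap keeps \<open>\<eta> < 1\<close>. Since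
    \<open>\<eta> / 2 \<le> \<epsilon>\<close>, failure of resilience at
    \<open>1 / 2 + \<eta> / 2\<close> implies failure at \<open>1 / 2 + \<epsilon>\<close>.\<close>
  define \<eta> where "\<eta> = min (2 * \<epsilon>) (1 / 2)"
  have \<eta>: "0 < \<eta>" "\<eta> < 1" "1 / 2 + \<eta> / 2 \<le> 1 / 2 + \<epsilon>" using assms(1) by (auto simp: \<eta>_def)
  define bad where "bad m = {Gs. \<exists>L. is_giant (Gs ! m) L \<and> resilient (1 / 2 + \<eta> / 2) connected_graph (L :: nat graph)}" for m
  obtain K C where single: "\<And>n m. 2 \<le> n \<Longrightarrow> m \<le> n choose 2 \<Longrightarrow> real n * ln (real n) / 6 \<le> real m \<Longrightarrow>
       ?P n (bad m) \<le> real n ^ 2 * (C / real n ^ 5 + exp (real n * (K - ln (real n) / 27)))"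
  proof (rule prob_resilient_giant_le[OF \<eta>(1,2)], goal_cases)
    case (1 K C)
    show ?case by (rule that, unfold bad_def, rule 1)
  qed
  \<comment> \<open>One factor \<open>n ^ 2\<close> stems from the bound \<open>single\<close>, the
    other from the number of times \<open>m\<close>.\<close>
  define r where "r n = real n ^ 4 * (C / real n ^ 5 + exp (real n * (K - ln (real n) / 27)))" for n
  have lower: "\<forall>\<^sub>F n in sequentially. 1 - r n \<le> ?P n (?good n)"
    using assms(2) eventually_ge_at_top[of 2]
  proof eventually_elim
    case (elim n)
    let ?M = "{m\<^sub>0 n..n choose 2}"
    let ?b = "real n ^ 2 * (C / real n ^ 5 + exp (real n * (K - ln (real n) / 27)))"
    have each: "?P n (bad m) \<le> ?b" if "m \<in> ?M" for m
    proof -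
      have "0 \<le> \<epsilon> * (real n * ln n)" using elim assms(1) by simp
      then have "real n * ln (real n) / 6 \<le> real (m\<^sub>0 n)" using elim by (simp add: algebra_simps)
      then show ?thesis using elim that by (intro single) auto
    qed
    \<comment> \<open>The sign of \<open>C\<close> is not recorded in \<open>single\<close>; that
      the bound is nonnegative follows from the probability below it.\<close>
    have b: "0 \<le> ?b"
      by (rule order_trans[OF measure_nonneg each[of "m\<^sub>0 n"]]) (use elim in auto)
    have "- ?good n \<subseteq> (\<Union>m\<in>?M. bad m)"
    proof
      fix Gs :: "nat graph list" assume "Gs \<in> - ?good n"
      then obtain m L where "m \<in> ?M" "is_giant (Gs ! m) L" "resilient (1 / 2 + \<epsilon>) connected_graph L"
        by (auto simp del: split_paired_All split_paired_Ex)
      then show "Gs \<in> (\<Union>m\<in>?M. bad m)"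
        using resilient_antimono[OF \<eta>(3)] unfolding bad_def by blast
    qed
    then have "?P n (- ?good n) \<le> ?P n (\<Union>m\<in>?M. bad m)"
      by (intro measure_pmf.finite_measure_mono) auto
    also have "\<dots> \<le> (\<Sum>m\<in>?M. ?P n (bad m))"
      by (intro measure_pmf.finite_measure_subadditive_finite) auto
    also have "\<dots> \<le> (\<Sum>m\<in>?M. ?b)" by (intro sum_mono each)
    also have "\<dots> = real (card ?M) * ?b" by simp
    also have "\<dots> \<le> real n ^ 2 * ?b"
    proof (rule mult_right_mono[OF _ b])
      have "real (card ?M) \<le> real ((n choose 2) + 1)" by simp
      also have "\<dots> \<le> real n ^ 2" using elim by (intro choose_two_plus_one_le) simp
      finally show "real (card ?M) \<le> real n ^ 2" .
    qed
    also have "\<dots> = r n" by (simp add: r_def power_numeral_reduce)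
    finally have "?P n (- ?good n) \<le> r n" .
    moreover have "?P n (- ?good n) = 1 - ?P n (?good n)"
      using measure_pmf.prob_compl[of "?good n" "random_graph_process n"] by (simp add: Compl_eq_Diff_UNIV)
    ultimately show ?case by simp
  qed
  have lim: "(\<lambda>n. 1 - r n) \<longlonglongrightarrow> 1"
  proof -
    \<comment> \<open>The first term is \<open>C / n\<close>; in the second the exponent tends to
      minus infinity faster than linearly, which beats \<open>n ^ 4\<close>.\<close>
    have "r \<longlonglongrightarrow> 0" unfolding r_def by real_asymp
    then show ?thesis using tendsto_diff[OF tendsto_const, of r 0 sequentially 1] by simp
  qed
  have upper: "\<forall>\<^sub>F n in sequentially. ?P n (?good n) \<le> 1" by simp
  show ?thesis by (rule real_tendsto_sandwich[OF lower upper lim tendsto_const])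
qed

end
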